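(* Let $\vec X_1,\dots,\vec X_n$ be drawn from a strictly stationary sequence of continuous $d$-dimensional random vectors with continuous margins $F_1,\dots,F_d$ and copula $C$, and let $\vec U_i=(F_1(X_{i1}),\dots,F_d(X_{id}))$. Assume: (i) $(\vec U_i)_{i\in\mathbb{Z}}$ is strictly stationary and $\tilde{\mathbb{B}}_n$ converges weakly in $\ell^\infty([0,1]^{d+1})$ to a tight centered Gaussian process $\mathbb{B}_C$ concentrated on the set of $\alpha\in\mathcal C([0,1]^{d+1})$ such that $\alpha(s,\vec u)=0$ whenever one of the components of $(s,\vec u)$ is $0$, and $\alpha(s,1,\dots,1)=0$ for all $s\in(0,1]$; (ii) for each $j\in\{1,\dots,d\}$ the partial derivative $\dot C_j=\partial C/\partial u_j$ exists and is continuous on $\{\vec u\in[0,1]^d:u_j\in(0,1)\}$; (iii) for each $j\in\{1,\dots,d\}$, with probability one there are no ties among $X_{1j},\dots,X_{nj}$. Then $$\sup_{(s,t,\vec u)\in\Delta\times[0,1]^d}|\mathbb{C}_n(s,t,\vec u)-\tilde{\mathbb{C}}_n(s,t,\vec u)|\to0\ \text{in probability},$$ where $\tilde{\mathbb{C}}_n(s,t,\vec u)=\{\tilde{\mathbb{B}}_n(t,\vec u)-\tilde{\mathbb{B}}_n(s,\vec u)\}-\sum_{j=1}^d\dot C_j(\vec u)\{\tilde{\mathbb{B}}_n(t,\vec u^{(j)})-\tilde{\mathbb{B}}_n(s,\vec u^{(j)})\}$. Consequently $\mathbb{C}_n\leadsto\mathbb{C}_C$ in $\ell^\infty(\Delta\times[0,1]^d)$,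 where $$\mathbb{C}_C(s,t,\vec u)=\{\mathbb{B}_C(t,\vec u)-\mathbb{B}_C(s,\vec u)\}-\sum_{j=1}^d\dot C_j(\vec u)\{\mathbb{B}_C(t,\vec u^{(j)})-\mathbb{B}_C(s,\vec u^{(j)})\}.$$
   Context: $\Delta=\{(s,t)\in[0,1]^2:s\le t\}$; $\lfloor y\rfloor$ is the integer part. $\tilde{\mathbb{B}}_n(s,\vec u)=n^{-1/2}\sum_{i=1}^{\lfloor ns\rfloor}\{\mathbf 1(\vec U_i\le\vec u)-C(\vec u)\}$ for $(s,\vec u)\in[0,1]^{d+1}$. For $1\le k\le l\le n$, let $R^{k:l}_{ij}$ be the rank of $X_{ij}$ among $X_{kj},\dots,X_{lj}$, $\hat U^{k:l}_{ij}=R^{k:l}_{ij}/(l-k+1)$ and $\hat{\vec U}^{k:l}_i=(\hat U^{k:l}_{i1},\dots,\hat U^{k:l}_{id})$. The two-sided sequential empirical copula process is $\mathbb{C}_n(s,t,\vec u)=n^{-1/2}\sum_{i=\lfloor ns\rfloor+1}^{\lfloor nt\rfloor}\{\mathbf 1(\hat{\vec U}^{\lfloor ns\rfloor+1:\lfloor nt\rfloor}_i\le\vec u)-C(\vec u)\}$ for $(s,t,\vec u)\in\Delta\times[0,1]^d$ (an empty sum is $0$). $\dot C_j$ is set to $0$ on $\{\vec u:u_j\in\{0,1\}\}$. For $\vec u\in[0,1]^d$, $\vec u^{(j)}$ is the vector whose $j$th component is $u_j$ and all other components equal $1$. $\leadsto$ is weak convergence in the Hoffmann-Jørgensen sense;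 $\mathcal C(T)$ denotes continuous functions on $T$. *)

theory Defs
  imports "HOL-Probability.Probability"
begin

definition outer_exp :: "'a measure \<Rightarrow> ('a \<Rightarrow> real) \<Rightarrow> real" where
  "outer_exp M Z = Inf {integral\<^sup>L M Y | Y. Y \<in> borel_measurable M \<and> integrable M Y
                         \<and> (\<forall>\<omega>\<in>space M. Z \<omega> \<le> Y \<omega>)}"

definition outer_prob :: "'a measure \<Rightarrow> 'a set \<Rightarrow> real" where
  "outer_prob M A = Inf {measure M B | B. B \<in> sets M \<and> A \<inter> space M \<subseteq> B}"

definition in_linf :: "'t set \<Rightarrow> ('t \<Rightarrow> real) \<Rightarrow> bool" where
  "in_linf T x \<longleftrightarrow> bdd_above ((\<lambda>t. \<bar>x t\<bar>) ` T)"

definition linf_dist :: "'t set \<Rightarrow> ('t \<Rightarrow> real) \<Rightarrow> ('t \<Rightarrow> real) \<Rightarrow> real" where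
  "linf_dist T x y = (SUP t\<in>T. \<bar>x t - y t\<bar>)"

definition linf_bcont :: "'t set \<Rightarrow> (('t \<Rightarrow> real) \<Rightarrow> real) \<Rightarrow> bool" where
  "linf_bcont T f \<longleftrightarrow>
     (\<exists>K. \<forall>x. in_linf T x \<longrightarrow> \<bar>f x\<bar> \<le> K) \<and>
     (\<forall>x. in_linf T x \<longrightarrow> (\<forall>e>0. \<exists>\<delta>>0. \<forall>y. in_linf T y \<and> linf_dist T x y < \<delta>
                                              \<longrightarrow> \<bar>f y - f x\<bar> < e))"

definition linf_compact :: "'t set \<Rightarrow> ('t \<Rightarrow> real) set \<Rightarrow> bool" where
  "linf_compact T K \<longleftrightarrow> (\<forall>x\<in>K. in_linf T x) \<and>
     (\<forall>s. (\<forall>n::nat. s n \<in> K) \<longrightarrow>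
        (\<exists>r x. strict_mono r \<and> x \<in> K \<and> (\<lambda>n::nat. linf_dist T (s (r n)) x) \<longlonglongrightarrow> 0))"

text \<open>Borel measurable (for metric spaces: f o X measurable for all bounded continuous f)
  and tight l-infinity(T)-valued map\<close>
definition linf_borel :: "'b measure \<Rightarrow> 't set \<Rightarrow> ('b \<Rightarrow> 't \<Rightarrow> real) \<Rightarrow> bool" where
  "linf_borel N T X \<longleftrightarrow> (\<forall>\<omega>\<in>space N. in_linf T (X \<omega>)) \<and>
     (\<forall>f. linf_bcont T f \<longrightarrow> (\<lambda>\<omega>. f (X \<omega>)) \<in> borel_measurable N)"

definition linf_tight :: "'b measure \<Rightarrow> 't set \<Rightarrow> ('b \<Rightarrow> 't \<Rightarrow> real) \<Rightarrow> bool" where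
  "linf_tight N T X \<longleftrightarrow> (\<forall>e>0. \<exists>K A. linf_compact T K \<and> A \<in> sets N \<and>
       A \<subseteq> {\<omega>\<in>space N. X \<omega> \<in> K} \<and> measure N A \<ge> 1 - e)"

definition hj_weak_conv :: "'a measure \<Rightarrow> (nat \<Rightarrow> 'a \<Rightarrow> 't \<Rightarrow> real) \<Rightarrow> 'b measure
                            \<Rightarrow> ('b \<Rightarrow> 't \<Rightarrow> real) \<Rightarrow> 't set \<Rightarrow> bool" where
  "hj_weak_conv M Xn N X T \<longleftrightarrow>
     (\<forall>n. \<forall>\<omega>\<in>space M. in_linf T (Xn n \<omega>)) \<and> linf_borel N T X \<and>
     (\<forall>f. linf_bcont T f \<longrightarrow>
        (\<lambda>n. outer_exp M (\<lambda>\<omega>. f (Xn n \<omega>))) \<longlonglongrightarrow> integral\<^sup>L N (\<lambda>\<omega>. f (X \<omega>)))"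

definition centered_gaussian :: "'b measure \<Rightarrow> 't set \<Rightarrow> ('b \<Rightarrow> 't \<Rightarrow> real) \<Rightarrow> bool" where
  "centered_gaussian N T X \<longleftrightarrow>
     (\<forall>(ts :: 't list) (a :: real list). set ts \<subseteq> T \<longrightarrow> length a = length ts \<longrightarrow>
        (let Y = (\<lambda>\<omega>. \<Sum>i<length ts. a ! i * X \<omega> (ts ! i)) in
          Y \<in> borel_measurable N \<and>
          (distr N borel Y = return borel 0 \<or>
           (\<exists>\<sigma>>0. distr N borel Y = density lborel (normal_density 0 \<sigma>)))))"

definition strictly_stationary :: "'a measure \<Rightarrow> (int \<Rightarrow> 'a \<Rightarrow> 'v::topological_space) \<Rightarrow> bool" where
  "strictly_stationary M X \<longleftrightarrow>
     (\<forall>h::int. \<forall>I. finite I \<longrightarrow>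
        distr M (Pi\<^sub>M I (\<lambda>_. borel)) (\<lambda>\<omega>. \<lambda>i\<in>I. X (i + h) \<omega>) =
        distr M (Pi\<^sub>M I (\<lambda>_. borel)) (\<lambda>\<omega>. \<lambda>i\<in>I. X i \<omega>))"

definition unit_cube :: "(real^'d) set" where
  "unit_cube = {u. \<forall>j. 0 \<le> u $ j \<and> u $ j \<le> 1}"

definition T1 :: "(real \<times> (real^'d)) set" where
  "T1 = {0..1} \<times> unit_cube"

definition Delta_cube :: "(real \<times> real \<times> (real^'d)) set" where
  "Delta_cube = {(s, t, u). 0 \<le> s \<and> s \<le> t \<and> t \<le> 1 \<and> u \<in> unit_cube}"

text \<open>j-th marginal distribution function F_j (of X_0; by stationarity of all X_i)\<close>
definition margin :: "'a measure \<Rightarrow> (int \<Rightarrow> 'a \<Rightarrow> real^'d) \<Rightarrow> 'd \<Rightarrow> real \<Rightarrow> real" where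
  "margin M X j x = measure M {\<omega>\<in>space M. X 0 \<omega> $ j \<le> x}"

definition Upit :: "'a measure \<Rightarrow> (int \<Rightarrow> 'a \<Rightarrow> real^'d) \<Rightarrow> int \<Rightarrow> 'a \<Rightarrow> real^'d" where
  "Upit M X i \<omega> = (\<chi> j. margin M X j (X i \<omega> $ j))"

definition copula :: "'a measure \<Rightarrow> (int \<Rightarrow> 'a \<Rightarrow> real^'d) \<Rightarrow> real^'d \<Rightarrow> real" where
  "copula M X u = measure M {\<omega>\<in>space M. \<forall>j. Upit M X 0 \<omega> $ j \<le> u $ j}"

definition upd :: "real^'d \<Rightarrow> 'd \<Rightarrow> real \<Rightarrow> real^'d" where
  "upd u j x = (\<chi> k. if k = j then x else u $ k)"

definition uj :: "real^'d \<Rightarrow> 'd \<Rightarrow> real^'d" where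
  "uj u j = (\<chi> k. if k = j then u $ j else 1)"

definition Cdot :: "(real^'d \<Rightarrow> real) \<Rightarrow> 'd \<Rightarrow> real^'d \<Rightarrow> real" where
  "Cdot C j u = (if 0 < u $ j \<and> u $ j < 1 then deriv (\<lambda>x. C (upd u j x)) (u $ j) else 0)"

definition Bt :: "'a measure \<Rightarrow> (int \<Rightarrow> 'a \<Rightarrow> real^'d) \<Rightarrow> nat \<Rightarrow> 'a \<Rightarrow> real \<times> (real^'d) \<Rightarrow> real" where
  "Bt M X n \<omega> p = (case p of (s, u) \<Rightarrow>
     (1 / sqrt (real n)) * (\<Sum>i\<in>{1..nat \<lfloor>real n * s\<rfloor>}.
        ((if \<forall>j. Upit M X (int i) \<omega> $ j \<le> u $ j then 1 else 0) - copula M X u)))"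

definition rank :: "(int \<Rightarrow> 'a \<Rightarrow> real^'d) \<Rightarrow> 'a \<Rightarrow> nat \<Rightarrow> nat \<Rightarrow> nat \<Rightarrow> 'd \<Rightarrow> nat" where
  "rank X \<omega> k l i j = card {m\<in>{k..l}. X (int m) \<omega> $ j \<le> X (int i) \<omega> $ j}"

definition Cn :: "'a measure \<Rightarrow> (int \<Rightarrow> 'a \<Rightarrow> real^'d) \<Rightarrow> nat \<Rightarrow> 'a \<Rightarrow> real \<times> real \<times> (real^'d) \<Rightarrow> real" where
  "Cn M X n \<omega> p = (case p of (s, t, u) \<Rightarrow>
     (let a = nat \<lfloor>real n * s\<rfloor>; b = nat \<lfloor>real n * t\<rfloor> in
     (1 / sqrt (real n)) * (\<Sum>i\<in>{a<..b}.
        ((if \<forall>j. real (rank X \<omega> (a + 1) b i j) / real (b - a) \<le> u $ j then 1 else 0)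
          - copula M X u))))"

definition approx_proc :: "(real^'d \<Rightarrow> real) \<Rightarrow> (real \<times> (real^'d) \<Rightarrow> real) \<Rightarrow> real \<times> real \<times> (real^'d) \<Rightarrow> real" where
  "approx_proc C Z p = (case p of (s, t, u) \<Rightarrow>
     (Z (t, u) - Z (s, u)) - (\<Sum>j\<in>UNIV. Cdot C j u * (Z (t, uj u j) - Z (s, uj u j))))"

end

theory Submission
  imports Defs
begin

text \<open>
  Fix a block \<open>{a<..b}\<close> with \<open>a = \<lfloor>ns\<rfloor>\<close>, \<open>b = \<lfloor>nt\<rfloor>\<close>, and put \<open>L = (b - a) / sqrt n\<close> and
  \<open>D x = B(t, x) - B(s, x)\<close> for the sequential empirical process \<open>B\<close>. Without ties, replacing ranks by
  the empirical quantile vector \<open>v\<close> of the block gives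
  \<open>Cn(s, t, u) = D v + L (C v - C u)\<close>, and the margins give \<open>L (v\<^sub>j - u\<^sub>j) = - D(v\<^sup>(j)) + O(1 / sqrt n)\<close>.
  On an event of outer probability close to one, \<open>B\<close> is bounded and equicontinuous. If \<open>(b - a) / n\<close> is
  small, \<open>D\<close> is small everywhere and all terms vanish since \<open>C\<close> is 1-Lipschitz in each coordinate.
  Otherwise \<open>v\<close> is uniformly close to \<open>u\<close>, and the mean value theorem along one coordinate at a time
  linearises \<open>C v - C u\<close>: for \<open>u\<^sub>j\<close> away from 0 and 1 the partial derivative is uniformly continuous, and
  for \<open>u\<^sub>j\<close> near 0 or 1 the factor \<open>D(u\<^sup>(j))\<close> is small because \<open>B\<close> vanishes on that boundary.
  Weak convergence then follows from the continuous mapping theorem and a Slutsky argument.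
\<close>

section \<open>Outer expectations and weak convergence of bounded functions\<close>

lemma outer_prob_le:
  assumes "B \<in> sets M" "A \<inter> space M \<subseteq> B"
  shows "outer_prob M A \<le> measure M B"
  unfolding outer_prob_def using assms
  by (intro cInf_lower) (auto intro!: bdd_belowI[where m=0])

lemma outer_prob_nonneg: "0 \<le> outer_prob M A"
  unfolding outer_prob_def by (intro cInf_greatest) auto

text \<open>The lower bound \<open>l\<close> on \<open>Z\<close> keeps the integrals of all
  majorants above \<open>l\<close>; the real-valued \<open>Inf\<close> is a genuine lower bound only
  for a set that is bounded below.\<close>

lemma outer_exp_le:
  assumes "prob_space M" "integrable M Y" "\<And>\<omega>. \<omega> \<in> space M \<Longrightarrow> Z \<omega> \<le> Y \<omega>"
    "\<And>\<omega>. \<omega> \<in> space M \<Longrightarrow> l \<le> Z \<omega>"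
  shows "outer_exp M Z \<le> integral\<^sup>L M Y"
proof -
  interpret prob_space M by fact
  have "l \<le> integral\<^sup>L M W" if "integrable M W" "\<forall>\<omega>\<in>space M. Z \<omega> \<le> W \<omega>" for W
  proof -
    have "integral\<^sup>L M (\<lambda>_. l) \<le> integral\<^sup>L M W"
      using that assms(4) by (intro integral_mono) (auto intro: order_trans)
    then show ?thesis by (simp add: prob_space)
  qed
  then have "bdd_below {integral\<^sup>L M Y | Y. Y \<in> borel_measurable M \<and> integrable M Y
                         \<and> (\<forall>\<omega>\<in>space M. Z \<omega> \<le> Y \<omega>)}"
    by (auto intro!: bdd_belowI[where m=l])
  then show ?thesis
    unfolding outer_exp_def using assms by (intro cInf_lower) auto
qed

text \<open>The upper bound \<open>K\<close> supplies one integrable majorant, so the infimum runs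
  over a nonempty set and near-optimal majorants exist.\<close>

lemma outer_exp_lessD:
  assumes "prob_space M" "\<And>\<omega>. \<omega> \<in> space M \<Longrightarrow> Z \<omega> \<le> K" "outer_exp M Z < c"
  shows "\<exists>Y. integrable M Y \<and> (\<forall>\<omega>\<in>space M. Z \<omega> \<le> Y \<omega>) \<and> integral\<^sup>L M Y < c"
proof -
  interpret prob_space M by fact
  let ?S = "{integral\<^sup>L M Y | Y. Y \<in> borel_measurable M \<and> integrable M Y
                         \<and> (\<forall>\<omega>\<in>space M. Z \<omega> \<le> Y \<omega>)}"
  have "integral\<^sup>L M (\<lambda>_. K) \<in> ?S" using assms(2) by (intro CollectI exI[of _ "\<lambda>_. K"]) auto
  then have "?S \<noteq> {}" by blast
  from cInf_lessD[OF this] assms(3) show ?thesis unfolding outer_exp_def by auto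
qed

text \<open>If \<open>Y\<close> is a near-optimal majorant of \<open>Z'\<close>, then
  \<open>Y + e + 2 * K * indicator B\<close> majorises \<open>Z\<close>: off \<open>B\<close> by
  \<open>le\<close>, on \<open>B\<close> because \<open>Z\<close> and \<open>Z'\<close> differ by at
  most \<open>2 * K\<close>. With \<open>B\<close> empty and \<open>e = 0\<close> this is
  monotonicity of the outer expectation.\<close>

lemma outer_exp_perturb:
  assumes M: "prob_space M" and B: "B \<in> sets M"
    and K: "\<And>\<omega>. \<omega> \<in> space M \<Longrightarrow> \<bar>Z \<omega>\<bar> \<le> K" "\<And>\<omega>. \<omega> \<in> space M \<Longrightarrow> \<bar>Z' \<omega>\<bar> \<le> K"
    and le: "\<And>\<omega>. \<omega> \<in> space M \<Longrightarrow> \<omega> \<notin> B \<Longrightarrow> Z \<omega> \<le> Z' \<omega> + e" and e: "0 \<le> e"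
  shows "outer_exp M Z \<le> outer_exp M Z' + e + 2 * K * measure M B"
proof (rule field_le_epsilon)
  interpret prob_space M by fact
  fix h :: real assume "0 < h"
  have "Z' \<omega> \<le> K" if "\<omega> \<in> space M" for \<omega> using K(2)[OF that] by simp
  from outer_exp_lessD[OF M, where Z=Z' and K=K and c="outer_exp M Z' + h"] this \<open>0 < h\<close>
  obtain Y where Y: "integrable M Y" "\<forall>\<omega>\<in>space M. Z' \<omega> \<le> Y \<omega>" "integral\<^sup>L M Y < outer_exp M Z' + h"
    by auto
  let ?W = "\<lambda>\<omega>. Y \<omega> + e + 2 * K * indicator B \<omega>"
  have iB: "integrable M (\<lambda>\<omega>. 2 * K * indicator B \<omega> :: real)" using B by (auto simp: emeasure_eq_measure)
  have "outer_exp M Z \<le> integral\<^sup>L M ?W"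
  proof (rule outer_exp_le[OF M, where l="-K"])
    show "integrable M ?W" using Y(1) iB by (intro Bochner_Integration.integrable_add) auto
    fix \<omega> assume w: "\<omega> \<in> space M"
    show "-K \<le> Z \<omega>" using K(1)[OF w] by linarith
    show "Z \<omega> \<le> ?W \<omega>"
      using K(1)[OF w] K(2)[OF w] le[OF w] Y(2)[rule_format, OF w] e
      by (cases "\<omega> \<in> B") auto
  qed
  also have "\<dots> = integral\<^sup>L M Y + e + 2 * K * measure M B"
    using Y(1) iB B by (simp add: prob_space)
  finally show "outer_exp M Z \<le> outer_exp M Z' + e + 2 * K * measure M B + h"
    using Y(3) by linarith
qed

text \<open>Markov's inequality is applied to a measurable majorant, which yields a measurable
  exceptional set. Several such sets can then be united with additive control of their
  measure.\<close>

lemma outer_exp_markov: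
  assumes M: "prob_space M" and Z: "\<And>\<omega>. \<omega> \<in> space M \<Longrightarrow> 0 \<le> Z \<omega>" "\<And>\<omega>. \<omega> \<in> space M \<Longrightarrow> Z \<omega> \<le> K"
    and c: "outer_exp M Z < c"
  shows "\<exists>B\<in>sets M. measure M B < c \<and> (\<forall>\<omega>\<in>space M - B. Z \<omega> < 1)"
proof -
  interpret prob_space M by fact
  obtain Y where Y: "integrable M Y" "\<forall>\<omega>\<in>space M. Z \<omega> \<le> Y \<omega>" "integral\<^sup>L M Y < c"
    using outer_exp_lessD[OF M Z(2) c] by auto
  have Y0: "0 \<le> Y \<omega>" if "\<omega> \<in> space M" for \<omega> using Y(2) Z(1)[OF that] that by force
  let ?B = "{\<omega> \<in> space M. 1 \<le> Y \<omega>}"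
  have "measure M ?B \<le> integral\<^sup>L M Y / 1"
    by (rule integral_Markov_inequality_measure[where A="{}"]) (use Y Y0 in auto)
  then have "measure M ?B < c" using Y(3) by simp
  moreover have "?B \<in> sets M" using Y(1) by measurable
  moreover have "\<forall>\<omega>\<in>space M - ?B. Z \<omega> < 1" using Y(2) by force
  ultimately show ?thesis by blast
qed

section \<open>The supremum distance and Lipschitz functionals of bounded functions\<close>

lemma linf_dist_le:
  assumes "T \<noteq> {}" "\<And>t. t \<in> T \<Longrightarrow> \<bar>x t - y t\<bar> \<le> c" shows "linf_dist T x y \<le> c"
  unfolding linf_dist_def using assms by (intro cSUP_least) auto

lemma in_linf_diff_bdd:
  assumes "in_linf T x" "in_linf T y" shows "bdd_above ((\<lambda>t. \<bar>x t - y t\<bar>) ` T)"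
proof -
  obtain a b where "\<And>t. t \<in> T \<Longrightarrow> \<bar>x t\<bar> \<le> a" "\<And>t. t \<in> T \<Longrightarrow> \<bar>y t\<bar> \<le> b"
    using assms unfolding in_linf_def bdd_above_def by auto
  then have "\<bar>x t - y t\<bar> \<le> a + b" if "t \<in> T" for t
    using that by (meson abs_triangle_ineq4 add_mono order_trans)
  then show ?thesis by (auto intro!: bdd_aboveI)
qed

lemma linf_dist_ge:
  assumes "in_linf T x" "in_linf T y" "t \<in> T" shows "\<bar>x t - y t\<bar> \<le> linf_dist T x y"
  unfolding linf_dist_def using in_linf_diff_bdd[OF assms(1,2)] assms(3) by (intro cSUP_upper) auto

lemma linf_dist_nonneg:
  assumes "T \<noteq> {}" "in_linf T x" "in_linf T y" shows "0 \<le> linf_dist T x y"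
proof -
  obtain t where "t \<in> T" using assms(1) by auto
  from linf_dist_ge[OF assms(2,3) this] show ?thesis by linarith
qed

lemma linf_dist_self: "T \<noteq> {} \<Longrightarrow> linf_dist T x x = 0"
  unfolding linf_dist_def by simp

lemma linf_dist_commute: "linf_dist T x y = linf_dist T y x"
  unfolding linf_dist_def by (simp add: abs_minus_commute)

lemma linf_dist_triangle:
  assumes "T \<noteq> {}" "in_linf T x" "in_linf T y" "in_linf T z"
  shows "linf_dist T x z \<le> linf_dist T x y + linf_dist T y z"
proof (rule linf_dist_le[OF assms(1)])
  fix t assume "t \<in> T"
  from linf_dist_ge[OF assms(2,3) this] linf_dist_ge[OF assms(3,4) this]
  show "\<bar>x t - z t\<bar> \<le> linf_dist T x y + linf_dist T y z" by linarith
qed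

definition linf_lipschitz :: "'t set \<Rightarrow> real \<Rightarrow> (('t \<Rightarrow> real) \<Rightarrow> real) \<Rightarrow> bool" where
  "linf_lipschitz T L f \<longleftrightarrow>
     (\<forall>x y. in_linf T x \<longrightarrow> in_linf T y \<longrightarrow> \<bar>f x - f y\<bar> \<le> L * linf_dist T x y)"

lemma linf_lipschitz_bcont:
  assumes "T \<noteq> {}" "linf_lipschitz T L f" "0 \<le> L" "\<And>x. in_linf T x \<Longrightarrow> \<bar>f x\<bar> \<le> K"
  shows "linf_bcont T f"
  unfolding linf_bcont_def
proof (intro conjI exI allI impI)
  fix x assume x: "in_linf T x"
  then show "\<bar>f x\<bar> \<le> K" by (rule assms(4))
  fix e :: real assume e: "0 < e"
  \<comment> \<open>The \<open>+ 1\<close> covers \<open>L = 0\<close>.\<close>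
  let ?d = "e / (L + 1)"
  show "0 < ?d" using e assms(3) by simp
  fix y assume y: "in_linf T y \<and> linf_dist T x y < ?d"
  have "\<bar>f y - f x\<bar> \<le> L * linf_dist T x y"
    using assms(2) x y unfolding linf_lipschitz_def by (metis linf_dist_commute)
  also have "\<dots> \<le> (L + 1) * linf_dist T x y"
    using linf_dist_nonneg[OF assms(1) x, of y] y by (simp add: algebra_simps)
  also have "\<dots> < e" using y assms(3) by (simp add: pos_less_divide_eq mult.commute)
  finally show "\<bar>f y - f x\<bar> < e" .
qed

text \<open>The functional \<open>min 1 (h x / c)\<close> is bounded and Lipschitz, so its outer
  expectations converge, and it equals 1 exactly where \<open>h x\<close> is at least
  \<open>c\<close>. Markov's inequality at level one then bounds the set where \<open>h\<close>
  reaches \<open>c\<close>.\<close>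

lemma hj_weak_conv_tail:
  assumes M: "prob_space M" and T: "T \<noteq> {}" and conv: "hj_weak_conv M Xn N X T"
    and h: "linf_lipschitz T L h" "0 \<le> L" "\<And>x. in_linf T x \<Longrightarrow> 0 \<le> h x"
    and c: "0 < c" "integral\<^sup>L N (\<lambda>\<omega>. min 1 (h (X \<omega>) / c)) < \<eta>"
  shows "\<forall>\<^sub>F n in sequentially. \<exists>B\<in>sets M. measure M B < \<eta> \<and> (\<forall>\<omega>\<in>space M - B. h (Xn n \<omega>) < c)"
proof -
  let ?f = "\<lambda>x. min 1 (h x / c)"
  have inX: "in_linf T (Xn n \<omega>)" if "\<omega> \<in> space M" for n \<omega>
    using conv that unfolding hj_weak_conv_def by auto
  have "\<bar>?f x - ?f y\<bar> \<le> L / c * linf_dist T x y" if "in_linf T x" "in_linf T y" for x y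
  proof -
    have "\<bar>?f x - ?f y\<bar> \<le> \<bar>h x / c - h y / c\<bar>" by linarith
    also have "\<dots> = \<bar>h x - h y\<bar> / c" using c by (simp add: diff_divide_distrib[symmetric])
    also have "\<dots> \<le> L * linf_dist T x y / c"
      using h(1) that c unfolding linf_lipschitz_def by (intro divide_right_mono) auto
    finally show ?thesis by simp
  qed
  then have "linf_lipschitz T (L / c) ?f" unfolding linf_lipschitz_def by auto
  then have "linf_bcont T ?f"
    by (rule linf_lipschitz_bcont[OF T, where K=1]) (use h c in auto)
  then have "(\<lambda>n. outer_exp M (\<lambda>\<omega>. ?f (Xn n \<omega>))) \<longlonglongrightarrow> integral\<^sup>L N (\<lambda>\<omega>. ?f (X \<omega>))"
    using conv unfolding hj_weak_conv_def by auto
  from order_tendstoD(2)[OF this c(2)]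
  show ?thesis
  proof eventually_elim
    case (elim n)
    obtain B where "B \<in> sets M" "measure M B < \<eta>" and *: "\<forall>\<omega>\<in>space M - B. ?f (Xn n \<omega>) < 1"
      using outer_exp_markov[OF M _ _ elim, where K=1] h(3)[OF inX] c(1) by auto
    moreover have "h (Xn n \<omega>) < c" if "\<omega> \<in> space M - B" for \<omega>
      using *[rule_format, OF that] c(1) by (simp add: min_less_iff_disj)
    ultimately show ?case by blast
  qed
qed

text \<open>Continuous mapping: \<open>f\<close> composed with \<Phi> is again a bounded continuous
  test functional, which transfers both the limit of outer expectations and the Borel measurability
  of the limit.\<close>

lemma hj_weak_conv_map:
  assumes conv: "hj_weak_conv M Xn N X T"
    and \<Phi>: "\<And>x. in_linf T x \<Longrightarrow> in_linf S (\<Phi> x)" and L: "0 \<le> L" and T: "T \<noteq> {}"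
    and lip: "\<And>x y. in_linf T x \<Longrightarrow> in_linf T y \<Longrightarrow> linf_dist S (\<Phi> x) (\<Phi> y) \<le> L * linf_dist T x y"
  shows "hj_weak_conv M (\<lambda>n \<omega>. \<Phi> (Xn n \<omega>)) N (\<lambda>\<omega>. \<Phi> (X \<omega>)) S"
proof -
  have bc: "linf_bcont T (\<lambda>x. f (\<Phi> x))" if f: "linf_bcont S f" for f
    unfolding linf_bcont_def
  proof (intro conjI allI impI)
    show "\<exists>K. \<forall>x. in_linf T x \<longrightarrow> \<bar>f (\<Phi> x)\<bar> \<le> K" using f \<Phi> unfolding linf_bcont_def by blast
    fix x e assume x: "in_linf T x" and "0 < (e::real)"
    then obtain d where d: "d > 0" "\<And>y. in_linf S y \<and> linf_dist S (\<Phi> x) y < d \<Longrightarrow> \<bar>f y - f (\<Phi> x)\<bar> < e"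
      using f \<Phi>[OF x] unfolding linf_bcont_def by meson
    show "\<exists>\<delta>>0. \<forall>y. in_linf T y \<and> linf_dist T x y < \<delta> \<longrightarrow> \<bar>f (\<Phi> y) - f (\<Phi> x)\<bar> < e"
    proof (intro exI[of _ "d / (L + 1)"] conjI allI impI)
      show "0 < d / (L + 1)" using d L by simp
      fix y assume y: "in_linf T y \<and> linf_dist T x y < d / (L + 1)"
      have "linf_dist S (\<Phi> x) (\<Phi> y) \<le> L * linf_dist T x y" using lip x y by auto
      also have "\<dots> \<le> (L + 1) * linf_dist T x y"
        using linf_dist_nonneg[OF T x] y by (simp add: algebra_simps)
      also have "\<dots> < d" using y L by (simp add: pos_less_divide_eq mult.commute)
      finally show "\<bar>f (\<Phi> y) - f (\<Phi> x)\<bar> < e" using d(2) \<Phi> y by blast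
    qed
  qed
  have 1: "(\<lambda>\<omega>. f (X \<omega>)) \<in> borel_measurable N"
    and 2: "(\<lambda>n. outer_exp M (\<lambda>\<omega>. f (Xn n \<omega>))) \<longlonglongrightarrow> integral\<^sup>L N (\<lambda>\<omega>. f (X \<omega>))"
    if "linf_bcont T f" for f
    using conv that unfolding hj_weak_conv_def linf_borel_def by auto
  show ?thesis
    using conv 1[OF bc] 2[OF bc] \<Phi> unfolding hj_weak_conv_def linf_borel_def by auto
qed

text \<open>Largest k-Lipschitz minorant. Approximating a bounded continuous functional from below and
  (after a sign change) from above by these reduces weak convergence to Lipschitz functionals,
  without using tightness.\<close>

definition linf_env :: "'t set \<Rightarrow> (('t \<Rightarrow> real) \<Rightarrow> real) \<Rightarrow> nat \<Rightarrow> ('t \<Rightarrow> real) \<Rightarrow> real" where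
  "linf_env T f k x = (INF y\<in>{y. in_linf T y}. f y + real k * linf_dist T x y)"

context
  fixes T :: "'t set" and f :: "('t \<Rightarrow> real) \<Rightarrow> real" and K :: real
  assumes T: "T \<noteq> {}" and K: "\<forall>x. in_linf T x \<longrightarrow> \<bar>f x\<bar> \<le> K"
begin

lemma linf_env_lower:
  assumes "in_linf T x" "in_linf T y"
  shows "linf_env T f k x \<le> f y + real k * linf_dist T x y"
  unfolding linf_env_def
proof (rule cINF_lower)
  have "- K \<le> f y + real k * linf_dist T x y" if "in_linf T y" for y
  proof -
    have "0 \<le> real k * linf_dist T x y" using linf_dist_nonneg[OF T assms(1) that] by simp
    then show ?thesis using K[rule_format, OF that] by linarith
  qed
  then show "bdd_below ((\<lambda>y. f y + real k * linf_dist T x y) ` {y. in_linf T y})"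
    by (auto intro!: bdd_belowI)
qed (use assms in auto)

lemma linf_env_greatest:
  assumes "in_linf T x" "\<And>y. in_linf T y \<Longrightarrow> c \<le> f y + real k * linf_dist T x y"
  shows "c \<le> linf_env T f k x"
  unfolding linf_env_def using assms by (intro cINF_greatest) auto

lemma linf_env_le: "in_linf T x \<Longrightarrow> linf_env T f k x \<le> f x"
  using linf_env_lower[of x x k] by (simp add: linf_dist_self T)

lemma linf_env_bounded:
  assumes "in_linf T x" shows "\<bar>linf_env T f k x\<bar> \<le> K"
proof -
  have "- K \<le> linf_env T f k x"
  proof (rule linf_env_greatest[OF assms])
    fix y assume y: "in_linf T y"
    have "0 \<le> real k * linf_dist T x y" using linf_dist_nonneg[OF T assms y] by simp
    then show "- K \<le> f y + real k * linf_dist T x y" using K[rule_format, OF y] by linarith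
  qed
  then show ?thesis using linf_env_le[OF assms, of k] K[rule_format, OF assms] by linarith
qed

lemma linf_env_lipschitz: "linf_lipschitz T (real k) (linf_env T f k)"
proof -
  have *: "linf_env T f k x - real k * linf_dist T x y \<le> linf_env T f k y"
    if x: "in_linf T x" and y: "in_linf T y" for x y
  proof (rule linf_env_greatest[OF y])
    fix z assume z: "in_linf T z"
    have "real k * linf_dist T x z \<le> real k * (linf_dist T x y + linf_dist T y z)"
      using linf_dist_triangle[OF T x y z] by (intro mult_left_mono) auto
    then show "linf_env T f k x - real k * linf_dist T x y \<le> f z + real k * linf_dist T y z"
      using linf_env_lower[OF x z, of k] by (simp add: algebra_simps)
  qed
  show ?thesis unfolding linf_lipschitz_def
  proof (intro allI impI)
    fix x y assume x: "in_linf T x" and y: "in_linf T y"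
    show "\<bar>linf_env T f k x - linf_env T f k y\<bar> \<le> real k * linf_dist T x y"
      using *[OF x y] *[OF y x] linf_dist_commute[of T x y] by simp
  qed
qed

text \<open>A competitor \<open>y\<close> near \<open>x\<close> has \<open>f y\<close> close to
  \<open>f x\<close> by continuity; a competitor at distance at least \<open>d\<close> pays a
  penalty of at least \<open>real k * d\<close>, which eventually exceeds the largest possible gain
  \<open>2 * K\<close>.\<close>

lemma linf_env_tendsto:
  assumes f: "linf_bcont T f" and x: "in_linf T x"
  shows "(\<lambda>k. linf_env T f k x) \<longlonglongrightarrow> f x"
proof (rule LIMSEQ_I)
  fix e :: real assume e: "0 < e"
  then obtain d where d: "d > 0" "\<And>y. in_linf T y \<and> linf_dist T x y < d \<Longrightarrow> \<bar>f y - f x\<bar> < e / 2"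
    using f x unfolding linf_bcont_def by (meson half_gt_zero)
  obtain k0 :: nat where k0: "2 * K / d \<le> real k0" using real_arch_simple by blast
  show "\<exists>no. \<forall>k\<ge>no. norm (linf_env T f k x - f x) < e"
  proof (intro exI allI impI)
    fix k assume k: "k \<ge> k0"
    have "f x - e / 2 \<le> linf_env T f k x"
    proof (rule linf_env_greatest[OF x])
      fix y assume y: "in_linf T y"
      have nn: "0 \<le> linf_dist T x y" by (rule linf_dist_nonneg[OF T x y])
      show "f x - e / 2 \<le> f y + real k * linf_dist T x y"
      proof (cases "linf_dist T x y < d")
        case True
        then have "\<bar>f y - f x\<bar> < e / 2" using d y by auto
        moreover have "0 \<le> real k * linf_dist T x y" using nn by simp
        ultimately show ?thesis by linarith
      next
        case False
        have "2 * K \<le> real k0 * d" using k0 d(1) by (simp add: pos_divide_le_eq)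
        also have "\<dots> \<le> real k * linf_dist T x y" using k False d(1) by (intro mult_mono) auto
        finally show ?thesis using K[rule_format, OF x] K[rule_format, OF y] e by linarith
      qed
    qed
    then show "norm (linf_env T f k x - f x) < e"
      using linf_env_le[OF x, of k] e by simp
  qed
qed

end

text \<open>Slutsky's argument. A Lipschitz functional turns closeness in supremum distance into
  closeness of values uniformly over all paths, which mere continuity does not do. A general bounded
  continuous functional is then squeezed between two Lipschitz envelopes.\<close>

lemma hj_weak_conv_close:
  assumes M: "prob_space M" and N: "prob_space N" and T: "T \<noteq> {}" and conv: "hj_weak_conv M Yn N G T"
    and Z: "\<And>n \<omega>. \<omega> \<in> space M \<Longrightarrow> in_linf T (Zn n \<omega>)"
    and close: "\<And>e \<eta>. e > 0 \<Longrightarrow> \<eta> > 0 \<Longrightarrow> \<forall>\<^sub>F n in sequentially. \<exists>B\<in>sets M. measure M B < \<eta> \<and>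
                  (\<forall>\<omega>\<in>space M - B. linf_dist T (Zn n \<omega>) (Yn n \<omega>) \<le> e)"
  shows "hj_weak_conv M Zn N G T"
proof -
  interpret M: prob_space M by fact
  interpret N: prob_space N by fact
  have Y: "in_linf T (Yn n \<omega>)" if "\<omega> \<in> space M" for n \<omega>
    using conv that unfolding hj_weak_conv_def by auto
  have G: "linf_borel N T G" using conv unfolding hj_weak_conv_def by auto
  then have inG: "in_linf T (G \<omega>)" if "\<omega> \<in> space N" for \<omega> using that unfolding linf_borel_def by auto
  have E: "\<forall>\<^sub>F n in sequentially. \<bar>outer_exp M (\<lambda>\<omega>. g (Zn n \<omega>)) - integral\<^sup>L N (\<lambda>\<omega>. g (G \<omega>))\<bar> < e"
    if g: "linf_lipschitz T (real k) g" "\<And>x. in_linf T x \<Longrightarrow> \<bar>g x\<bar> \<le> K" and e: "e > 0" for g k K and e :: real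
  proof -
    have "linf_bcont T g" by (rule linf_lipschitz_bcont[OF T g(1) _ g(2)]) auto
    then have "(\<lambda>n. outer_exp M (\<lambda>\<omega>. g (Yn n \<omega>))) \<longlonglongrightarrow> integral\<^sup>L N (\<lambda>\<omega>. g (G \<omega>))"
      using conv unfolding hj_weak_conv_def by auto
    then have 1: "\<forall>\<^sub>F n in sequentially. \<bar>outer_exp M (\<lambda>\<omega>. g (Yn n \<omega>)) - integral\<^sup>L N (\<lambda>\<omega>. g (G \<omega>))\<bar> < e / 2"
      using e by (auto dest!: tendstoD[where e="e/2"] simp: dist_real_def)
    \<comment> \<open>Moving from \<open>Yn\<close> to \<open>Zn\<close> costs at most
      \<open>e / 8\<close> off the exceptional set (through \<open>h\<close>) and at most
      \<open>e / 8\<close> on it (through \<open>\<eta>\<close>). Together with the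
      \<open>e / 2\<close> of the assumed convergence this stays below \<open>e\<close>. The two
      \<open>+ 1\<close> guard against zero denominators.\<close>
    define h where "h = e / (8 * (real k + 1))"
    define \<eta> where "\<eta> = e / (16 * (\<bar>K\<bar> + 1))"
    have h: "h > 0" "\<eta> > 0" using e by (auto simp: h_def \<eta>_def)
    have kh: "real k * h \<le> e / 8" using e by (simp add: h_def field_simps)
    from 1 close[OF h] show ?thesis
    proof eventually_elim
      case (elim n)
      then obtain B where B: "B \<in> sets M" "measure M B < \<eta>"
        and Bd: "\<And>\<omega>. \<omega> \<in> space M \<Longrightarrow> \<omega> \<notin> B \<Longrightarrow> linf_dist T (Zn n \<omega>) (Yn n \<omega>) \<le> h" by auto
      have gd: "\<bar>g (Zn n \<omega>) - g (Yn n \<omega>)\<bar> \<le> e / 8" if "\<omega> \<in> space M" "\<omega> \<notin> B" for \<omega>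
      proof -
        have "\<bar>g (Zn n \<omega>) - g (Yn n \<omega>)\<bar> \<le> real k * linf_dist T (Zn n \<omega>) (Yn n \<omega>)"
          using g(1) Z[OF that(1)] Y[OF that(1)] unfolding linf_lipschitz_def by auto
        also have "\<dots> \<le> real k * h" using Bd[OF that] by (intro mult_left_mono) auto
        finally show ?thesis using kh by linarith
      qed
      have KB: "2 * \<bar>K\<bar> * measure M B \<le> e / 8"
      proof -
        have "2 * \<bar>K\<bar> * measure M B \<le> 2 * (\<bar>K\<bar> + 1) * \<eta>" using B(2) by (intro mult_mono) auto
        also have "\<dots> = e / 8" by (simp add: \<eta>_def field_simps)
        finally show ?thesis .
      qed
      have gK: "\<bar>g x\<bar> \<le> \<bar>K\<bar>" if "in_linf T x" for x using g(2)[OF that] by linarith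
      have le1: "g (Zn n \<omega>) \<le> g (Yn n \<omega>) + e / 8" if "\<omega> \<in> space M" "\<omega> \<notin> B" for \<omega>
        using gd[OF that] by linarith
      have le2: "g (Yn n \<omega>) \<le> g (Zn n \<omega>) + e / 8" if "\<omega> \<in> space M" "\<omega> \<notin> B" for \<omega>
        using gd[OF that] by linarith
      have "outer_exp M (\<lambda>\<omega>. g (Zn n \<omega>)) \<le> outer_exp M (\<lambda>\<omega>. g (Yn n \<omega>)) + e / 8 + 2 * \<bar>K\<bar> * measure M B"
        by (rule outer_exp_perturb[OF M B(1) gK[OF Z] gK[OF Y] le1]) (use e in auto)
      moreover have "outer_exp M (\<lambda>\<omega>. g (Yn n \<omega>)) \<le> outer_exp M (\<lambda>\<omega>. g (Zn n \<omega>)) + e / 8 + 2 * \<bar>K\<bar> * measure M B"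
        by (rule outer_exp_perturb[OF M B(1) gK[OF Y] gK[OF Z] le2]) (use e in auto)
      ultimately show ?case using elim(1) KB e by linarith
    qed
  qed
  have "(\<lambda>n. outer_exp M (\<lambda>\<omega>. f (Zn n \<omega>))) \<longlonglongrightarrow> integral\<^sup>L N (\<lambda>\<omega>. f (G \<omega>))" if f: "linf_bcont T f" for f
  proof -
    obtain K where K: "\<forall>x. in_linf T x \<longrightarrow> \<bar>f x\<bar> \<le> K" using f unfolding linf_bcont_def by auto
    have K': "\<forall>x. in_linf T x \<longrightarrow> \<bar>- f x\<bar> \<le> K" using K by simp
    have f': "linf_bcont T (\<lambda>x. - f x)" using f unfolding linf_bcont_def by (simp add: abs_minus_commute)
    \<comment> \<open>The envelopes converge pointwise and are bounded by \<open>K\<close>, so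
      dominated convergence under the fixed limit law applies.\<close>
    have lim: "(\<lambda>k. integral\<^sup>L N (\<lambda>\<omega>. linf_env T g k (G \<omega>))) \<longlonglongrightarrow> integral\<^sup>L N (\<lambda>\<omega>. g (G \<omega>))"
      if g: "linf_bcont T g" and Kg: "\<forall>x. in_linf T x \<longrightarrow> \<bar>g x\<bar> \<le> K" for g
    proof (rule integral_dominated_convergence[where w="\<lambda>_. K"])
      show "(\<lambda>\<omega>. g (G \<omega>)) \<in> borel_measurable N" using G g unfolding linf_borel_def by auto
      show "(\<lambda>\<omega>. linf_env T g k (G \<omega>)) \<in> borel_measurable N" for k
        using G linf_lipschitz_bcont[OF T linf_env_lipschitz[OF T Kg] _ linf_env_bounded[OF T Kg]]
        unfolding linf_borel_def by auto
      show "AE \<omega> in N. (\<lambda>k. linf_env T g k (G \<omega>)) \<longlonglongrightarrow> g (G \<omega>)"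
        using linf_env_tendsto[OF T Kg g inG] by auto
      show "AE \<omega> in N. norm (linf_env T g k (G \<omega>)) \<le> K" for k
        using linf_env_bounded[OF T Kg inG] by auto
    qed simp
    show ?thesis
    proof (rule LIMSEQ_I)
      fix e :: real assume e: "0 < e"
      have "\<forall>\<^sub>F k in sequentially. dist (integral\<^sup>L N (\<lambda>\<omega>. linf_env T f k (G \<omega>))) (integral\<^sup>L N (\<lambda>\<omega>. f (G \<omega>))) < e / 2 \<and>
         dist (integral\<^sup>L N (\<lambda>\<omega>. linf_env T (\<lambda>x. - f x) k (G \<omega>))) (integral\<^sup>L N (\<lambda>\<omega>. - f (G \<omega>))) < e / 2"
        using lim[OF f K, THEN tendstoD, of "e/2"] lim[OF f' K', THEN tendstoD, of "e/2"] e
        by (auto intro: eventually_conj)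
      then obtain k where k: "\<bar>integral\<^sup>L N (\<lambda>\<omega>. linf_env T f k (G \<omega>)) - integral\<^sup>L N (\<lambda>\<omega>. f (G \<omega>))\<bar> < e / 2"
          "\<bar>integral\<^sup>L N (\<lambda>\<omega>. linf_env T (\<lambda>x. - f x) k (G \<omega>)) + integral\<^sup>L N (\<lambda>\<omega>. f (G \<omega>))\<bar> < e / 2"
        by (auto simp: eventually_sequentially dist_real_def)
      \<comment> \<open>Negating the envelope of \<open>- f\<close> produces a Lipschitz majorant of
        \<open>f\<close>.\<close>
      have lip: "linf_lipschitz T (real k) (\<lambda>x. - linf_env T (\<lambda>x. - f x) k x)"
        using linf_env_lipschitz[OF T K', of k] unfolding linf_lipschitz_def
        by (simp add: abs_minus_commute)
      have bd: "\<bar>- linf_env T (\<lambda>x. - f x) k x\<bar> \<le> K" if "in_linf T x" for x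
        using linf_env_bounded[OF T K' that] by simp
      have "\<forall>\<^sub>F n in sequentially. \<bar>outer_exp M (\<lambda>\<omega>. linf_env T f k (Zn n \<omega>)) - integral\<^sup>L N (\<lambda>\<omega>. linf_env T f k (G \<omega>))\<bar> < e / 2"
        by (rule E[OF linf_env_lipschitz[OF T K] linf_env_bounded[OF T K]]) (use e in auto)
      moreover have "\<forall>\<^sub>F n in sequentially. \<bar>outer_exp M (\<lambda>\<omega>. - linf_env T (\<lambda>x. - f x) k (Zn n \<omega>)) -
          integral\<^sup>L N (\<lambda>\<omega>. - linf_env T (\<lambda>x. - f x) k (G \<omega>))\<bar> < e / 2"
        by (rule E[OF lip bd]) (use e in auto)
      ultimately have "\<forall>\<^sub>F n in sequentially. norm (outer_exp M (\<lambda>\<omega>. f (Zn n \<omega>)) - integral\<^sup>L N (\<lambda>\<omega>. f (G \<omega>))) < e"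
      proof eventually_elim
        case (elim n)
        \<comment> \<open>The perturbation bound with an empty exceptional set gives monotonicity,
          first for the lower envelope and then for the upper one.\<close>
        have "outer_exp M (\<lambda>\<omega>. linf_env T f k (Zn n \<omega>)) \<le> outer_exp M (\<lambda>\<omega>. f (Zn n \<omega>)) + 0 + 2 * K * measure M {}"
          by (rule outer_exp_perturb[OF M])
            (use linf_env_bounded[OF T K Z] K[rule_format, OF Z] linf_env_le[OF T K Z] in auto)
        moreover have "outer_exp M (\<lambda>\<omega>. f (Zn n \<omega>)) \<le>
           outer_exp M (\<lambda>\<omega>. - linf_env T (\<lambda>x. - f x) k (Zn n \<omega>)) + 0 + 2 * K * measure M {}"
        proof (rule outer_exp_perturb[OF M])
          fix \<omega> assume "\<omega> \<in> space M"
          from linf_env_le[OF T K' Z[OF this, of n], of k]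
          show "f (Zn n \<omega>) \<le> - linf_env T (\<lambda>x. - f x) k (Zn n \<omega>) + 0" by simp
        qed (use bd[OF Z] K[rule_format, OF Z] in auto)
        ultimately show ?case
          using elim k
          by (simp only: Bochner_Integration.integral_minus real_norm_def measure_empty mult_zero_right add_0_right)
      qed
      then show "\<exists>no. \<forall>n\<ge>no. norm (outer_exp M (\<lambda>\<omega>. f (Zn n \<omega>)) - integral\<^sup>L N (\<lambda>\<omega>. f (G \<omega>))) < e"
        by (simp add: eventually_sequentially)
    qed
  qed
  then show ?thesis using Z G unfolding hj_weak_conv_def by auto
qed

section \<open>First-order expansion of a copula\<close>

lemma upd_nth [simp]: "upd u j x $ k = (if k = j then x else u $ k)"
  by (simp add: upd_def)

lemma uj_nth [simp]: "uj u j $ k = (if k = j then u $ j else 1)"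
  by (simp add: uj_def)

lemma upd_upd [simp]: "upd (upd u j x) j y = upd u j y"
  by (simp add: vec_eq_iff)

lemma upd_self [simp]: "upd u j (u $ j) = u"
  by (simp add: vec_eq_iff)

lemma upd_in_unit_cube: "u \<in> unit_cube \<Longrightarrow> 0 \<le> x \<Longrightarrow> x \<le> 1 \<Longrightarrow> upd u j x \<in> unit_cube"
  by (auto simp: unit_cube_def)

lemma uj_in_unit_cube: "u \<in> unit_cube \<Longrightarrow> uj u j \<in> unit_cube"
  by (auto simp: unit_cube_def)

lemma one_in_unit_cube: "(\<chi> j. 1) \<in> unit_cube"
  by (auto simp: unit_cube_def)

lemma compact_unit_cube: "compact (unit_cube :: (real^'d) set)"
proof -
  have "unit_cube = cbox (\<chi> j. 0) (\<chi> j. 1 :: real^'d)"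
    by (auto simp: unit_cube_def mem_box_cart)
  then show ?thesis by (metis compact_cbox)
qed

lemma dist_vec_le:
  fixes u v :: "real^'d" assumes "\<And>j. \<bar>u $ j - v $ j\<bar> \<le> c"
  shows "dist u v \<le> real CARD('d) * c"
proof -
  have "dist u v \<le> (\<Sum>j\<in>UNIV. \<bar>(u - v) $ j\<bar>)" unfolding dist_norm by (rule norm_le_l1_cart)
  also have "\<dots> \<le> (\<Sum>j\<in>(UNIV::'d set). c)" using assms by (intro sum_mono) simp
  finally show ?thesis by simp
qed

text \<open>These are the only facts about the copula that the expansion needs, so the linearisation
  is free of probability. Continuity of \<open>Cdot C j\<close> is asked for only where coordinate
  \<open>j\<close> is interior; it may jump to its default value 0 at the two faces.\<close>

locale smooth_copula =
  fixes C :: "real^'d \<Rightarrow> real"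
  assumes lip: "\<And>u j x y. u \<in> unit_cube \<Longrightarrow> 0 \<le> x \<Longrightarrow> x \<le> 1 \<Longrightarrow> 0 \<le> y \<Longrightarrow> y \<le> 1 \<Longrightarrow>
                  \<bar>C (upd u j x) - C (upd u j y)\<bar> \<le> \<bar>x - y\<bar>"
    and diff: "\<And>u j. u \<in> unit_cube \<Longrightarrow> 0 < u $ j \<Longrightarrow> u $ j < 1 \<Longrightarrow>
                  (\<lambda>x. C (upd u j x)) differentiable (at (u $ j))"
    and cont: "\<And>j. continuous_on {u\<in>unit_cube. 0 < u $ j \<and> u $ j < 1} (Cdot C j)"
begin

text \<open>For \<open>h\<close> so small that \<open>u $ j + h\<close> stays in the unit interval,
  \<open>lip\<close> bounds the difference quotients by 1, and the bound survives the limit. At the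
  faces the default value 0 satisfies it.\<close>

lemma Cdot_abs_le:
  assumes u: "u \<in> unit_cube" shows "\<bar>Cdot C j u\<bar> \<le> 1"
proof (cases "0 < u $ j \<and> u $ j < 1")
  case True
  let ?f = "\<lambda>x. C (upd u j x)"
  let ?D = "deriv ?f (u $ j)"
  have "(?f has_real_derivative ?D) (at (u $ j))"
    using diff[OF u, of j] True by (metis DERIV_imp_deriv real_differentiable_def)
  then have lim: "((\<lambda>h. \<bar>(?f (u $ j + h) - ?f (u $ j)) / h\<bar>) \<longlongrightarrow> \<bar>?D\<bar>) (at 0)"
    unfolding DERIV_def by (rule tendsto_rabs)
  have "\<forall>\<^sub>F h in at 0. \<bar>h\<bar> < min (u $ j) (1 - u $ j)"
    using True by (auto simp: eventually_at intro!: exI[of _ "min (u $ j) (1 - u $ j)"])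
  then have "\<forall>\<^sub>F h in at 0. \<bar>(?f (u $ j + h) - ?f (u $ j)) / h\<bar> \<le> 1"
  proof eventually_elim
    case (elim h)
    then have "\<bar>?f (u $ j + h) - ?f (u $ j)\<bar> \<le> \<bar>h\<bar>"
      using lip[OF u, of "u $ j + h" "u $ j" j] True by auto
    then show ?case by (cases "h = 0") (auto simp: divide_simps)
  qed
  from tendsto_upperbound[OF lim this] show ?thesis using True by (simp add: Cdot_def)
qed (auto simp: Cdot_def)

text \<open>Continuity on the open slab becomes uniform on a compact slab inside it. Only
  \<open>u\<close> has to keep the distance \<open>\<eta>\<close> from the faces; \<open>w\<close>
  is any point of the cube near \<open>u\<close>.\<close>

lemma Cdot_uniform:
  assumes \<eta>: "0 < \<eta>" and e: "0 < e"
  shows "\<exists>\<rho>>0. \<forall>j. \<forall>u\<in>unit_cube. \<forall>w\<in>unit_cube. \<eta> \<le> u $ j \<longrightarrow> u $ j \<le> 1 - \<eta> \<longrightarrow>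
           dist w u < \<rho> \<longrightarrow> \<bar>Cdot C j w - Cdot C j u\<bar> < e"
proof -
  have "\<exists>\<rho>>0. \<forall>u\<in>unit_cube. \<forall>w\<in>unit_cube. \<eta> \<le> u $ j \<longrightarrow> u $ j \<le> 1 - \<eta> \<longrightarrow>
           dist w u < \<rho> \<longrightarrow> \<bar>Cdot C j w - Cdot C j u\<bar> < e" for j
  proof -
    \<comment> \<open>Half the margin is given away so that \<open>w\<close>, which lies within
      \<open>\<eta> / 2\<close> of \<open>u\<close>, is still in the compact set.\<close>
    let ?K = "unit_cube \<inter> {u. \<eta> / 2 \<le> u $ j} \<inter> {u. u $ j \<le> 1 - \<eta> / 2}"
    have "compact ?K"
      by (intro compact_Int_closed compact_unit_cube closed_Collect_le continuous_intros)
    moreover have "continuous_on ?K (Cdot C j)"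
      by (rule continuous_on_subset[OF cont]) (use \<eta> in auto)
    ultimately have "uniformly_continuous_on ?K (Cdot C j)" by (rule compact_uniformly_continuous[rotated])
    then obtain d where d: "d > 0" "\<And>u w. u \<in> ?K \<Longrightarrow> w \<in> ?K \<Longrightarrow> dist w u < d \<Longrightarrow> dist (Cdot C j w) (Cdot C j u) < e"
      unfolding uniformly_continuous_on_def using e by metis
    show ?thesis
    proof (intro exI[of _ "min d (\<eta> / 2)"] conjI ballI impI)
      fix u w :: "real^'d"
      assume *: "u \<in> unit_cube" "w \<in> unit_cube" "\<eta> \<le> u $ j" "u $ j \<le> 1 - \<eta>" "dist w u < min d (\<eta> / 2)"
      have "\<bar>w $ j - u $ j\<bar> \<le> dist w u" using dist_vec_nth_le[of w j u] by (simp add: dist_real_def)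
      then have "w \<in> ?K" "u \<in> ?K" using * \<eta> by auto
      from d(2)[OF this(2,1)] * show "\<bar>Cdot C j w - Cdot C j u\<bar> < e" by (simp add: dist_real_def)
    qed (use d \<eta> in auto)
  qed
  then obtain \<rho> where \<rho>: "\<And>j. \<rho> j > 0" "\<And>j u w. u\<in>unit_cube \<Longrightarrow> w\<in>unit_cube \<Longrightarrow> \<eta> \<le> u $ j \<Longrightarrow> u $ j \<le> 1 - \<eta> \<Longrightarrow>
           dist w u < \<rho> j \<Longrightarrow> \<bar>Cdot C j w - Cdot C j u\<bar> < e" by metis
  have "Min (range \<rho>) > 0" using \<rho>(1) by (subst Min_gr_iff) auto
  moreover have "Min (range \<rho>) \<le> \<rho> j" for j by (rule Min_le) auto
  ultimately show ?thesis
    using \<rho>(2) by (intro exI[of _ "Min (range \<rho>)"] conjI allI ballI impI) (auto intro: less_le_trans)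
qed

text \<open>With \<open>c\<close> the mean value slope, the quantity equals
  \<open>c * (L * (y - w $ j) + r) - (c - Cdot C j u) * r\<close>. The first term is at most
  \<open>\<kappa>\<close> because slopes are bounded by 1. The second is at most
  \<open>2 * \<kappa>\<close>, either because \<open>r\<close> is small or because the slope is
  close to \<open>Cdot C j u\<close>; the alternative \<open>alt\<close> allows for both
  regimes.\<close>

lemma increment_bound:
  assumes w: "w \<in> unit_cube" and u: "u \<in> unit_cube" and y: "0 \<le> y" "y \<le> 1" and L: "0 \<le> L"
    and inc: "\<bar>L * (y - w $ j) + r\<bar> \<le> \<kappa>"
    and alt: "\<bar>r\<bar> \<le> \<kappa> \<or> (\<forall>x. min (w $ j) y < x \<and> x < max (w $ j) y \<longrightarrow>
                \<bar>Cdot C j (upd w j x) - Cdot C j u\<bar> * \<bar>r\<bar> \<le> \<kappa>)"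
  shows "\<bar>L * (C (upd w j y) - C w) + Cdot C j u * r\<bar> \<le> 3 * \<kappa>"
proof -
  let ?f = "\<lambda>x. C (upd w j x)"
  have wj: "0 \<le> w $ j" "w $ j \<le> 1" using w by (auto simp: unit_cube_def)
  have \<kappa>: "0 \<le> \<kappa>" using inc by linarith
  \<comment> \<open>The mean value theorem needs continuity up to the endpoints 0 and 1, where
    differentiability is not assumed; it comes from the Lipschitz bound.\<close>
  have cf: "continuous_on {0..1} ?f"
  proof (rule continuous_onI)
    fix x e :: real assume "x \<in> {0..1}" "0 < e"
    moreover have "dist (?f x') (?f x) \<le> dist x' x" if "x' \<in> {0..1}" for x'
      using lip[OF w, of x' x j] that \<open>x \<in> {0..1}\<close> by (simp add: dist_real_def)
    ultimately show "\<exists>d>0. \<forall>x'\<in>{0..1}. dist x' x < d \<longrightarrow> dist (?f x') (?f x) \<le> e"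
      by (intro exI[of _ e]) force
  qed
  have mvt: "\<exists>z. a < z \<and> z < b \<and> ?f b - ?f a = (b - a) * Cdot C j (upd w j z)"
    if ab: "a < b" "0 \<le> a" "b \<le> 1" for a b
  proof -
    have df: "?f differentiable (at x)" if "a < x" "x < b" for x
      using diff[of "upd w j x" j] upd_in_unit_cube[OF w] that ab by simp
    obtain l z where z: "a < z" "z < b" "DERIV ?f z :> l" "?f b - ?f a = (b - a) * l"
      using MVT[OF ab(1) continuous_on_subset[OF cf] df] ab by auto
    have "Cdot C j (upd w j z) = l" using z ab by (simp add: Cdot_def DERIV_imp_deriv)
    then show ?thesis using z by auto
  qed
  have Cu: "\<bar>Cdot C j u\<bar> \<le> 1" by (rule Cdot_abs_le[OF u])
  show ?thesis
  proof (cases "y = w $ j")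
    case True
    \<comment> \<open>Without an increment there is no intermediate point, but then
      \<open>inc\<close> itself says that \<open>r\<close> is small.\<close>
    have "\<bar>Cdot C j u * r\<bar> \<le> 1 * \<kappa>" unfolding abs_mult using True inc Cu by (intro mult_mono) auto
    then show ?thesis using True \<kappa> by simp
  next
    case False
    have "\<exists>z. min (w $ j) y < z \<and> z < max (w $ j) y \<and> ?f y - ?f (w $ j) = (y - w $ j) * Cdot C j (upd w j z)"
    proof (cases "w $ j < y")
      case True
      then show ?thesis using mvt[OF True] wj y by auto
    next
      case less: False
      then have "y < w $ j" using False by simp
      from mvt[OF this y(1) wj(2)] obtain z where "y < z" "z < w $ j"
        "?f (w $ j) - ?f y = (w $ j - y) * Cdot C j (upd w j z)" by auto
      then show ?thesis by (intro exI[of _ z]) (auto simp: algebra_simps)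
    qed
    then obtain z where z: "min (w $ j) y < z" "z < max (w $ j) y"
      and eq: "C (upd w j y) - C w = (y - w $ j) * Cdot C j (upd w j z)" by auto
    let ?c = "Cdot C j (upd w j z)"
    have zc: "\<bar>?c\<bar> \<le> 1"
      using Cdot_abs_le[OF upd_in_unit_cube[OF w, of z j], of j] z wj y by auto
    have "L * (C (upd w j y) - C w) + Cdot C j u * r = ?c * (L * (y - w $ j) + r) - (?c - Cdot C j u) * r"
      unfolding eq by (simp add: algebra_simps)
    moreover have "\<bar>?c * (L * (y - w $ j) + r)\<bar> \<le> 1 * \<kappa>"
      unfolding abs_mult using zc inc by (intro mult_mono) auto
    moreover have "\<bar>(?c - Cdot C j u) * r\<bar> \<le> 2 * \<kappa>"
      using alt
    proof
      assume "\<bar>r\<bar> \<le> \<kappa>"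
      then show ?thesis unfolding abs_mult using zc Cu by (intro mult_mono) auto
    next
      assume "\<forall>x. min (w $ j) y < x \<and> x < max (w $ j) y \<longrightarrow>
                \<bar>Cdot C j (upd w j x) - Cdot C j u\<bar> * \<bar>r\<bar> \<le> \<kappa>"
      then have "\<bar>?c - Cdot C j u\<bar> * \<bar>r\<bar> \<le> \<kappa>" using z by auto
      then show ?thesis using \<kappa> by (simp add: abs_mult)
    qed
    ultimately show ?thesis by linarith
  qed
qed

text \<open>The path from \<open>u\<close> to \<open>v\<close> changes one coordinate at a time, and
  each change costs \<open>3 * \<kappa>\<close> by the one-dimensional bound. Every point met on the
  way is coordinatewise no farther from \<open>u\<close> than \<open>v\<close> is, which is the
  region over which \<open>alt\<close> quantifies.\<close>

lemma expansion_bound: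
  assumes u: "u \<in> unit_cube" and v: "v \<in> unit_cube" and L: "0 \<le> L"
    and inc: "\<And>j. \<bar>L * (v $ j - u $ j) + r j\<bar> \<le> \<kappa>"
    and alt: "\<And>j. \<bar>r j\<bar> \<le> \<kappa> \<or> (\<forall>w\<in>unit_cube. (\<forall>k. \<bar>w $ k - u $ k\<bar> \<le> \<bar>v $ k - u $ k\<bar>) \<longrightarrow>
                \<bar>Cdot C j w - Cdot C j u\<bar> * \<bar>r j\<bar> \<le> \<kappa>)"
  shows "\<bar>L * (C v - C u) + (\<Sum>j\<in>UNIV. Cdot C j u * r j)\<bar> \<le> 3 * real CARD('d) * \<kappa>"
proof -
  \<comment> \<open>The corner of the path at which exactly the coordinates in \<open>S\<close> have
    been moved to \<open>v\<close>.\<close>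
  define mix where "mix S = (\<chi> k. if k \<in> S then v $ k else u $ k)" for S
  have "\<bar>L * (C (mix S) - C u) + (\<Sum>j\<in>S. Cdot C j u * r j)\<bar> \<le> 3 * real (card S) * \<kappa>"
    if "finite S" for S using that
  proof (induction S rule: finite_induct)
    case empty
    have "mix {} = u" by (simp add: mix_def vec_eq_iff)
    then show ?case by simp
  next
    case (insert j S)
    let ?w = "mix S"
    have wu: "?w \<in> unit_cube" using u v by (auto simp: unit_cube_def mix_def)
    have wj: "?w $ j = u $ j" using insert.hyps by (simp add: mix_def)
    have eq: "mix (insert j S) = upd ?w j (v $ j)" by (auto simp: mix_def vec_eq_iff)
    have vj: "0 \<le> v $ j" "v $ j \<le> 1" "0 \<le> u $ j" "u $ j \<le> 1" using u v by (auto simp: unit_cube_def)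
    have "\<bar>L * (C (upd ?w j (v $ j)) - C ?w) + Cdot C j u * r j\<bar> \<le> 3 * \<kappa>"
    proof (rule increment_bound[OF wu u vj(1,2) L])
      show "\<bar>L * (v $ j - ?w $ j) + r j\<bar> \<le> \<kappa>" using inc[of j] wj by simp
      show "\<bar>r j\<bar> \<le> \<kappa> \<or> (\<forall>x. min (?w $ j) (v $ j) < x \<and> x < max (?w $ j) (v $ j) \<longrightarrow>
          \<bar>Cdot C j (upd ?w j x) - Cdot C j u\<bar> * \<bar>r j\<bar> \<le> \<kappa>)"
      proof (rule disj_forward[OF alt[of j]])
        assume *: "\<forall>w\<in>unit_cube. (\<forall>k. \<bar>w $ k - u $ k\<bar> \<le> \<bar>v $ k - u $ k\<bar>) \<longrightarrow>
                \<bar>Cdot C j w - Cdot C j u\<bar> * \<bar>r j\<bar> \<le> \<kappa>"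
        show "\<forall>x. min (?w $ j) (v $ j) < x \<and> x < max (?w $ j) (v $ j) \<longrightarrow>
          \<bar>Cdot C j (upd ?w j x) - Cdot C j u\<bar> * \<bar>r j\<bar> \<le> \<kappa>"
        proof (intro allI impI)
          fix x assume x: "min (?w $ j) (v $ j) < x \<and> x < max (?w $ j) (v $ j)"
          have "\<bar>upd ?w j x $ k - u $ k\<bar> \<le> \<bar>v $ k - u $ k\<bar>" for k
            using x wj by (auto simp: mix_def min_def max_def split: if_splits)
          moreover have "upd ?w j x \<in> unit_cube"
            using x wj vj by (intro upd_in_unit_cube[OF wu]) auto
          ultimately show "\<bar>Cdot C j (upd ?w j x) - Cdot C j u\<bar> * \<bar>r j\<bar> \<le> \<kappa>" using * by blast
        qed
      qed
    qed
    moreover have "L * (C (mix (insert j S)) - C u) = L * (C (upd ?w j (v $ j)) - C ?w) + L * (C ?w - C u)"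
      unfolding eq by (simp add: algebra_simps)
    moreover have "3 * real (card (insert j S)) * \<kappa> = 3 * \<kappa> + 3 * real (card S) * \<kappa>"
      using insert.hyps by (simp add: algebra_simps)
    moreover have "(\<Sum>j\<in>insert j S. Cdot C j u * r j) = Cdot C j u * r j + (\<Sum>j\<in>S. Cdot C j u * r j)"
      using insert.hyps by simp
    ultimately show ?case using insert.IH by linarith
  qed
  from this[of UNIV] show ?thesis by (simp add: mix_def)
qed

end

section \<open>Ranks and the probability integral transform\<close>

text \<open>Without ties the ranks are pairwise distinct, hence a bijection of \<open>S\<close> onto
  \<open>{1..card S}\<close>, and exactly \<open>k\<close> of these values are at most
  \<open>k\<close>.\<close>

lemma card_rank_le:
  fixes f :: "'i \<Rightarrow> real"
  assumes S: "finite S" and inj: "inj_on f S" and k: "k \<le> card S"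
  shows "card {i\<in>S. card {m\<in>S. f m \<le> f i} \<le> k} = k"
proof -
  let ?r = "\<lambda>i. card {m\<in>S. f m \<le> f i}"
  have less: "?r i < ?r i'" if "i' \<in> S" "f i < f i'" for i i'
  proof (rule psubset_card_mono)
    have "i' \<in> {m\<in>S. f m \<le> f i'} - {m\<in>S. f m \<le> f i}" using that by auto
    then show "{m\<in>S. f m \<le> f i} \<subset> {m\<in>S. f m \<le> f i'}" using that by fastforce
  qed (use S in simp)
  have rinj: "inj_on ?r S"
  proof (rule inj_onI)
    fix i i' assume *: "i \<in> S" "i' \<in> S" "?r i = ?r i'"
    then have "f i = f i'" using less[of i' i] less[of i i'] by (cases "f i" "f i'" rule: linorder_cases) auto
    then show "i = i'" using inj * by (auto dest: inj_onD)
  qed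
  have "?r ` S \<subseteq> {1..card S}"
  proof (clarsimp, intro conjI)
    fix i assume i: "i \<in> S"
    show "Suc 0 \<le> ?r i" using S i by (simp add: Suc_le_eq card_gt_0_iff) blast
    show "?r i \<le> card S" using S by (intro card_mono) auto
  qed
  moreover have "card (?r ` S) = card {1..card S}" using rinj by (simp add: card_image)
  ultimately have im: "?r ` S = {1..card S}" by (intro card_subset_eq) auto
  have "?r ` {i\<in>S. ?r i \<le> k} = {1..k}"
  proof -
    have "?r ` {i\<in>S. ?r i \<le> k} = ?r ` S \<inter> {..k}" by auto
    then show ?thesis using im k by auto
  qed
  moreover have "card (?r ` {i\<in>S. ?r i \<le> k}) = card {i\<in>S. ?r i \<le> k}"
    by (rule card_image[OF inj_on_subset[OF rinj]]) auto
  ultimately show ?thesis by simp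
qed

locale stationary_sample = prob_space M for M :: "'a measure" +
  fixes X :: "int \<Rightarrow> 'a \<Rightarrow> real^'d::finite"
  assumes X_rv: "\<And>i. X i \<in> borel_measurable M"
    and X_stat: "strictly_stationary M X"
    and margins_cont: "\<And>j. continuous_on UNIV (margin M X j)"
begin

abbreviation "U \<equiv> Upit M X"
abbreviation "C \<equiv> copula M X"

section \<open>Margins and uniformity of the transformed observations\<close>

lemma X_nth_measurable [measurable]: "(\<lambda>\<omega>. X i \<omega> $ j) \<in> borel_measurable M"
proof -
  have "(\<lambda>x::real^'d. x $ j) \<in> borel_measurable borel"
    by (intro borel_measurable_continuous_onI continuous_intros)
  from measurable_compose[OF X_rv this] show ?thesis .
qed

lemma U_nth: "U i \<omega> $ j = margin M X j (X i \<omega> $ j)"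
  by (simp add: Upit_def)

lemma U_nth_measurable [measurable]: "(\<lambda>\<omega>. U i \<omega> $ j) \<in> borel_measurable M"
  unfolding U_nth
  by (rule measurable_compose[OF X_nth_measurable borel_measurable_continuous_onI[OF margins_cont]])

text \<open>Stationarity is used for the one-point index set \<open>{0}\<close> with shift
  \<open>i\<close>; evaluation at 0 then recovers the laws of single observations.\<close>

lemma distr_X: "distr M borel (X i) = distr M borel (X 0)"
proof -
  let ?P = "Pi\<^sub>M {0::int} (\<lambda>_. borel :: (real^'d) measure)"
  have meas: "(\<lambda>\<omega>. \<lambda>k\<in>{0}. X (k + h) \<omega>) \<in> measurable M ?P" for h
    using X_rv by (intro measurable_restrict) auto
  have proj: "distr (distr M ?P (\<lambda>\<omega>. \<lambda>k\<in>{0}. X (k + h) \<omega>)) borel (\<lambda>g. g 0) = distr M borel (X h)" for h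
    by (subst distr_distr[OF _ meas]) (auto simp: comp_def)
  have "distr M ?P (\<lambda>\<omega>. \<lambda>k\<in>{0}. X (k + i) \<omega>) = distr M ?P (\<lambda>\<omega>. \<lambda>k\<in>{0}. X (k + 0) \<omega>)"
    using X_stat unfolding strictly_stationary_def by simp
  then show ?thesis using proj[of i] proj[of 0] by metis
qed

lemma prob_X_le: "prob {\<omega>\<in>space M. X i \<omega> $ j \<le> x} = margin M X j x"
proof -
  have A: "{y::real^'d. y $ j \<le> x} \<in> sets borel"
    by (intro borel_closed closed_Collect_le continuous_intros)
  have "prob {\<omega>\<in>space M. X h \<omega> $ j \<le> x} = measure (distr M borel (X h)) {y. y $ j \<le> x}" for h
    using X_rv A by (subst measure_distr) (auto intro!: arg_cong[where f=prob])
  then show ?thesis using distr_X[of i] by (simp add: margin_def)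
qed

lemma margin_cdf: "margin M X j = cdf (distr M borel (\<lambda>\<omega>. X 0 \<omega> $ j))"
  by (rule ext) (auto simp: margin_def cdf_def measure_distr intro!: arg_cong[where f=prob])

lemma real_distribution_X: "real_distribution (distr M borel (\<lambda>\<omega>. X 0 \<omega> $ j))"
  by (rule real_distribution_distr) simp

lemma margin_mono: "x \<le> y \<Longrightarrow> margin M X j x \<le> margin M X j y"
proof -
  interpret R: real_distribution "distr M borel (\<lambda>\<omega>. X 0 \<omega> $ j)" by (rule real_distribution_X)
  show "x \<le> y \<Longrightarrow> margin M X j x \<le> margin M X j y" unfolding margin_cdf by (rule R.cdf_nondecreasing)
qed

text \<open>The intermediate value theorem between the limits 0 and 1 at the two infinities. The
  levels 0 and 1 are excluded since a distribution function need not attain them.\<close>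

lemma margin_surj:
  assumes "0 < u" "u < 1" shows "\<exists>x. margin M X j x = u"
proof -
  interpret R: real_distribution "distr M borel (\<lambda>\<omega>. X 0 \<omega> $ j)" by (rule real_distribution_X)
  have "\<forall>\<^sub>F x in at_bot. margin M X j x < u"
    using order_tendstoD(2)[OF R.cdf_lim_at_bot assms(1)] by (simp add: margin_cdf)
  then obtain a where a: "margin M X j a < u" by (auto simp: eventually_at_bot_linorder)
  have "\<forall>\<^sub>F x in at_top. u < margin M X j x"
    using order_tendstoD(1)[OF R.cdf_lim_at_top_prob assms(2)] by (simp add: margin_cdf)
  then obtain b where b: "u < margin M X j b" by (auto simp: eventually_at_top_linorder)
  have "a \<le> b" using margin_mono[of b a j] a b by linarith
  with a b show ?thesis
    using IVT'[of "margin M X j" a u b] continuous_on_subset[OF margins_cont] by auto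
qed

lemma U_bounds: "0 \<le> U i \<omega> $ j" "U i \<omega> $ j \<le> 1"
  by (auto simp: U_nth margin_def)

text \<open>If the margin takes the value \<open>w > u\<close> at \<open>x\<close>, the event lies
  in \<open>X i \<omega> $ j \<le> x\<close>, which has probability \<open>w\<close>; then
  \<open>w\<close> decreases to \<open>u\<close>. The strict inequality is essential because the
  margin may have flat pieces. The lower bound is monotonicity at a point where the margin equals
  \<open>u\<close>.\<close>

lemma prob_U_le:
  assumes "0 \<le> u" "u \<le> 1" shows "prob {\<omega>\<in>space M. U i \<omega> $ j \<le> u} = u"
proof (cases "u = 1")
  case True
  then show ?thesis using U_bounds prob_space by simp
next
  case False
  show ?thesis
  proof (rule antisym)
    show "prob {\<omega>\<in>space M. U i \<omega> $ j \<le> u} \<le> u"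
    proof (rule dense_ge_bounded[of u 1])
      fix w assume w: "u < w" "w < 1"
      then obtain x where x: "margin M X j x = w" using margin_surj[of w j] assms by auto
      have "prob {\<omega>\<in>space M. U i \<omega> $ j \<le> u} \<le> prob {\<omega>\<in>space M. X i \<omega> $ j \<le> x}"
      proof (rule finite_measure_mono)
        show "{\<omega>\<in>space M. U i \<omega> $ j \<le> u} \<subseteq> {\<omega>\<in>space M. X i \<omega> $ j \<le> x}"
        proof clarify
          fix \<omega> assume "U i \<omega> $ j \<le> u"
          then have "margin M X j (X i \<omega> $ j) < margin M X j x" using x w by (simp add: U_nth)
          then show "X i \<omega> $ j \<le> x" using margin_mono[of x "X i \<omega> $ j" j] by linarith
        qed
      qed measurable
      then show "prob {\<omega>\<in>space M. U i \<omega> $ j \<le> u} \<le> w" using x prob_X_le by simp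
    qed (use False assms in auto)
    show "u \<le> prob {\<omega>\<in>space M. U i \<omega> $ j \<le> u}"
    proof (cases "u = 0")
      case False
      then obtain x where x: "margin M X j x = u" using margin_surj[of u j] assms \<open>u \<noteq> 1\<close> by auto
      have "prob {\<omega>\<in>space M. X i \<omega> $ j \<le> x} \<le> prob {\<omega>\<in>space M. U i \<omega> $ j \<le> u}"
      proof (rule finite_measure_mono)
        show "{\<omega>\<in>space M. X i \<omega> $ j \<le> x} \<subseteq> {\<omega>\<in>space M. U i \<omega> $ j \<le> u}"
          using x margin_mono by (auto simp: U_nth)
      qed measurable
      then show ?thesis using x prob_X_le by simp
    qed simp
  qed
qed

text \<open>The almost sure properties on which the pathwise argument rests. The second clause says
  that flat pieces of a margin do not destroy the order of the sample. All indices are quantified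
  inside, so one null set serves every \<open>n\<close>.\<close>

definition regular :: "'a \<Rightarrow> bool" where
  "regular \<omega> \<longleftrightarrow> (\<forall>i j. 0 < U i \<omega> $ j) \<and> (\<forall>i i' j. U i \<omega> $ j \<le> U i' \<omega> $ j \<longrightarrow> X i \<omega> $ j \<le> X i' \<omega> $ j)
     \<and> (\<forall>n j. inj_on (\<lambda>i. X (int i) \<omega> $ j) {1..n})"

lemma AE_U_pos: "AE \<omega> in M. 0 < U i \<omega> $ j"
proof -
  have "{\<omega>\<in>space M. U i \<omega> $ j \<le> 0} \<in> null_sets M"
    using prob_U_le[of 0 i j] by (intro null_setsI) (simp_all add: emeasure_eq_measure)
  from AE_not_in[OF this] show ?thesis using AE_space by eventually_elim auto
qed

text \<open>The event on the right is contained in the one on the left and both have probability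
  \<open>margin M X j x\<close>, so their difference is null.\<close>

lemma AE_U_le_margin: "AE \<omega> in M. U i \<omega> $ j \<le> margin M X j x \<longrightarrow> X i \<omega> $ j \<le> x"
proof -
  let ?A = "{\<omega>\<in>space M. U i \<omega> $ j \<le> margin M X j x}" and ?B = "{\<omega>\<in>space M. X i \<omega> $ j \<le> x}"
  have AB: "?A \<in> sets M" "?B \<in> sets M" by measurable
  have sub: "?B \<subseteq> ?A" using margin_mono by (auto simp: U_nth)
  have "prob (?A - ?B) = prob ?A - prob ?B" by (rule finite_measure_Diff[OF AB sub])
  also have "prob ?A = margin M X j x" by (rule prob_U_le) (auto simp: margin_def)
  finally have "prob (?A - ?B) = 0" using prob_X_le by simp
  then have "?A - ?B \<in> null_sets M" using AB by (intro null_setsI) (auto simp: emeasure_eq_measure)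
  from AE_not_in[OF this] show ?thesis using AE_space by eventually_elim auto
qed

text \<open>A violation of the order would leave a rational strictly between the two observations,
  and at rational thresholds only countably many null sets have to be removed.\<close>

lemma AE_regular:
  assumes no_ties: "\<And>n j. AE \<omega> in M. inj_on (\<lambda>i. X (int i) \<omega> $ j) {1..n}"
  shows "AE \<omega> in M. regular \<omega>"
proof -
  have 1: "AE \<omega> in M. \<forall>i j. 0 < U i \<omega> $ j" using AE_U_pos by (simp add: AE_all_countable)
  have 2: "AE \<omega> in M. \<forall>i j (q::rat). U i \<omega> $ j \<le> margin M X j (of_rat q) \<longrightarrow> X i \<omega> $ j \<le> of_rat q"
    unfolding AE_all_countable using AE_U_le_margin by simp
  have 3: "AE \<omega> in M. \<forall>n j. inj_on (\<lambda>i. X (int i) \<omega> $ j) {1..n}"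
    unfolding AE_all_countable using no_ties by simp
  from 1 2 3 show ?thesis
  proof eventually_elim
    case (elim \<omega>)
    have "X i \<omega> $ j \<le> X i' \<omega> $ j" if le: "U i \<omega> $ j \<le> U i' \<omega> $ j" for i i' j
    proof (rule ccontr)
      assume "\<not> X i \<omega> $ j \<le> X i' \<omega> $ j"
      then obtain q where q: "X i' \<omega> $ j < of_rat q" "of_rat q < X i \<omega> $ j"
        using of_rat_dense[of "X i' \<omega> $ j" "X i \<omega> $ j"] by auto
      have "U i' \<omega> $ j \<le> margin M X j (of_rat q)" using margin_mono q(1) by (simp add: U_nth)
      with le have "X i \<omega> $ j \<le> of_rat q" using elim(2) by fastforce
      with q show False by simp
    qed
    then show ?case using elim by (auto simp: regular_def)
  qed
qed

section \<open>Elementary properties of the copula\<close>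

lemma copula_bounds: "0 \<le> C u" "C u \<le> 1"
  by (auto simp: copula_def)

lemma copula_uj:
  assumes "u \<in> unit_cube" shows "C (uj u j) = u $ j"
proof -
  have "{\<omega>\<in>space M. \<forall>k. U 0 \<omega> $ k \<le> uj u j $ k} = {\<omega>\<in>space M. U 0 \<omega> $ j \<le> u $ j}"
    using U_bounds by auto
  then show ?thesis using prob_U_le[of "u $ j" 0 j] assms by (simp add: copula_def unit_cube_def)
qed

lemma copula_one: "C (\<chi> j. 1) = 1"
  using U_bounds prob_space by (simp add: copula_def)

lemma copula_zero:
  assumes "u $ j = 0" shows "C u = 0"
proof -
  have "C u \<le> prob {\<omega>\<in>space M. U 0 \<omega> $ j \<le> 0}"
    unfolding copula_def using assms by (intro finite_measure_mono) (auto dest: spec[where x=j])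
  then show ?thesis using prob_U_le[of 0 0 j] copula_bounds(1)[of u] by simp
qed

text \<open>Raising coordinate \<open>j\<close> from \<open>y\<close> to \<open>x\<close> enlarges
  the event only by outcomes whose \<open>j\<close>-th transformed value lies in the half-open
  interval from \<open>y\<close> to \<open>x\<close>, and by uniformity these have probability
  \<open>x - y\<close>.\<close>

lemma copula_upd_diff:
  assumes "0 \<le> y" "y \<le> x" "x \<le> 1"
  shows "C (upd u j y) \<le> C (upd u j x)" "C (upd u j x) \<le> C (upd u j y) + (x - y)"
proof -
  let ?A = "\<lambda>x. {\<omega>\<in>space M. \<forall>k. U 0 \<omega> $ k \<le> upd u j x $ k}"
  let ?B = "{\<omega>\<in>space M. U 0 \<omega> $ j \<le> x} - {\<omega>\<in>space M. U 0 \<omega> $ j \<le> y}"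
  show "C (upd u j y) \<le> C (upd u j x)"
    unfolding copula_def
    by (rule finite_measure_mono) (use assms in \<open>auto split: if_splits intro: order_trans\<close>)
  have "prob (?A x) \<le> prob (?A y \<union> ?B)"
    by (rule finite_measure_mono) (auto split: if_splits)
  also have "\<dots> \<le> prob (?A y) + prob ?B"
    by (rule measure_Un_le) measurable
  also have "prob ?B = x - y"
    by (subst finite_measure_Diff) (use assms in \<open>auto simp: prob_U_le\<close>)
  finally show "C (upd u j x) \<le> C (upd u j y) + (x - y)" by (simp add: copula_def)
qed

lemma copula_lip:
  assumes "0 \<le> x" "x \<le> 1" "0 \<le> y" "y \<le> 1"
  shows "\<bar>C (upd u j x) - C (upd u j y)\<bar> \<le> \<bar>x - y\<bar>"
proof (cases "y \<le> x")
  case True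
  then show ?thesis using copula_upd_diff[of y x u j] assms by linarith
next
  case False
  then show ?thesis using copula_upd_diff[of x y u j] assms by linarith
qed

text \<open>The threshold \<open>v\<close> is the empirical quantile: its \<open>j\<close>-th component is the largest \<open>U\<close>-value
  whose normalised rank is at most \<open>u\<^sub>j\<close>. The value 0 stands for the case of no such rank, which is
  harmless because all \<open>U\<close>-values are positive.\<close>

lemma rank_threshold:
  assumes g: "regular \<omega>" and ab: "a < b" and u: "u \<in> unit_cube"
  obtains v where "v \<in> unit_cube"
    "\<And>i j. i \<in> {a<..b} \<Longrightarrow> real (rank X \<omega> (a + 1) b i j) / real (b - a) \<le> u $ j \<longleftrightarrow> U (int i) \<omega> $ j \<le> v $ j"
    "\<And>j. \<bar>real (card {i\<in>{a<..b}. U (int i) \<omega> $ j \<le> v $ j}) - real (b - a) * u $ j\<bar> \<le> 1"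
proof -
  let ?S = "{a<..b}"
  let ?J = "\<lambda>j. {i\<in>?S. real (rank X \<omega> (a + 1) b i j) / real (b - a) \<le> u $ j}"
  define v where "v = (\<chi> j. Max (insert 0 ((\<lambda>i. U (int i) \<omega> $ j) ` ?J j)))"
  have fin: "finite (insert 0 ((\<lambda>i. U (int i) \<omega> $ j) ` ?J j))" for j by simp
  have vin: "v $ j \<in> insert 0 ((\<lambda>i. U (int i) \<omega> $ j) ` ?J j)" for j
    using Max_in[OF fin[of j]] by (simp add: v_def)
  have Suc: "{a + 1..b} = ?S" by auto
  have iff: "real (rank X \<omega> (a + 1) b i j) / real (b - a) \<le> u $ j \<longleftrightarrow> U (int i) \<omega> $ j \<le> v $ j"
    if i: "i \<in> ?S" for i j
  proof
    assume "real (rank X \<omega> (a + 1) b i j) / real (b - a) \<le> u $ j"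
    then show "U (int i) \<omega> $ j \<le> v $ j"
      using i fin[of j] unfolding v_def by (simp only: vec_lambda_beta) (rule Max_ge, auto)
  next
    assume le: "U (int i) \<omega> $ j \<le> v $ j"
    have "v $ j \<noteq> 0" using le g unfolding regular_def by (metis not_le)
    then obtain i' where i': "i' \<in> ?J j" "v $ j = U (int i') \<omega> $ j" using vin[of j] by auto
    then have "X (int i) \<omega> $ j \<le> X (int i') \<omega> $ j" using le g unfolding regular_def by auto
    then have "rank X \<omega> (a + 1) b i j \<le> rank X \<omega> (a + 1) b i' j"
      unfolding rank_def by (intro card_mono) auto
    then have "real (rank X \<omega> (a + 1) b i j) / real (b - a) \<le> real (rank X \<omega> (a + 1) b i' j) / real (b - a)"
      by (intro divide_right_mono) auto
    then show "real (rank X \<omega> (a + 1) b i j) / real (b - a) \<le> u $ j" using i' by auto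
  qed
  have "0 \<le> v $ j \<and> v $ j \<le> 1" for j using vin[of j] U_bounds by auto
  then have "v \<in> unit_cube" by (simp add: unit_cube_def)
  moreover have "\<bar>real (card {i\<in>?S. U (int i) \<omega> $ j \<le> v $ j}) - real (b - a) * u $ j\<bar> \<le> 1" for j
  proof -
    have u0: "0 \<le> u $ j" "u $ j \<le> 1" using u by (auto simp: unit_cube_def)
    \<comment> \<open>Ranks are integers, so being at most \<open>real (b - a) * u $ j\<close> is
      the same as being at most its integer part. Exactly \<open>k\<close> ranks qualify, and
      rounding is the only source of the error 1.\<close>
    define k where "k = nat \<lfloor>real (b - a) * u $ j\<rfloor>"
    have nn: "0 \<le> real (b - a) * u $ j" using u0 by simp
    have kle: "k \<le> b - a"
    proof -
      have "real (b - a) * u $ j \<le> real (b - a) * 1" using u0 by (intro mult_left_mono) auto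
      then show ?thesis unfolding k_def by (simp add: nat_le_iff floor_le_iff)
    qed
    have "{i\<in>?S. U (int i) \<omega> $ j \<le> v $ j} = {i\<in>?S. card {m\<in>?S. X (int m) \<omega> $ j \<le> X (int i) \<omega> $ j} \<le> k}"
    proof (intro Collect_cong conj_cong refl)
      fix i assume "i \<in> ?S"
      from iff[OF this, of j] have "U (int i) \<omega> $ j \<le> v $ j \<longleftrightarrow> real (rank X \<omega> (a + 1) b i j) \<le> real (b - a) * u $ j"
        using ab by (simp add: pos_divide_le_eq mult.commute)
      also have "\<dots> \<longleftrightarrow> rank X \<omega> (a + 1) b i j \<le> k"
        unfolding k_def using nn by (simp add: le_nat_iff le_floor_iff)
      finally show "U (int i) \<omega> $ j \<le> v $ j \<longleftrightarrow> card {m\<in>?S. X (int m) \<omega> $ j \<le> X (int i) \<omega> $ j} \<le> k"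
        unfolding rank_def Suc .
    qed
    moreover have "inj_on (\<lambda>i. X (int i) \<omega> $ j) ?S"
      using g by (intro inj_on_subset[of _ "{1..b}" ?S]) (auto simp: regular_def)
    ultimately have "card {i\<in>?S. U (int i) \<omega> $ j \<le> v $ j} = k" using card_rank_le[of ?S _ k] kle by simp
    moreover have "\<bar>real k - real (b - a) * u $ j\<bar> \<le> 1" unfolding k_def using nn by linarith
    ultimately show ?thesis by simp
  qed
  ultimately show ?thesis using iff that by blast
qed

lemma Bt_increment:
  assumes "s \<le> t"
  shows "Bt M X n \<omega> (t, x) - Bt M X n \<omega> (s, x) = (1 / sqrt (real n)) *
    (\<Sum>i\<in>{nat \<lfloor>real n * s\<rfloor><..nat \<lfloor>real n * t\<rfloor>}. (if \<forall>j. U (int i) \<omega> $ j \<le> x $ j then 1 else 0) - C x)"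
proof -
  let ?a = "nat \<lfloor>real n * s\<rfloor>" and ?b = "nat \<lfloor>real n * t\<rfloor>"
  have "?a \<le> ?b" using assms by (intro nat_mono floor_mono mult_left_mono) auto
  then have "{1..?b} = {1..?a} \<union> {?a<..?b}" "{1..?a} \<inter> {?a<..?b} = {}" by auto
  then show ?thesis by (simp add: Bt_def sum.union_disjoint ring_distribs add_divide_distrib)
qed

text \<open>At the threshold \<open>v\<close> the rank indicators become indicators of the
  unobserved uniforms, and recentring at \<open>C v\<close> instead of \<open>C u\<close> leaves the
  drift \<open>L * (C v - C u)\<close>. The error \<open>1 / sqrt (real n)\<close> is the rounding
  error of one observation after scaling.\<close>

lemma Cn_representation:
  fixes s t :: real and n :: nat
  defines "a \<equiv> nat \<lfloor>real n * s\<rfloor>" and "b \<equiv> nat \<lfloor>real n * t\<rfloor>"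
  defines "L \<equiv> real (b - a) / sqrt (real n)" and "D \<equiv> \<lambda>\<omega> x. Bt M X n \<omega> (t, x) - Bt M X n \<omega> (s, x)"
  assumes g: "regular \<omega>" and st: "s \<le> t" and ab: "a < b" and u: "u \<in> unit_cube"
  obtains v where "v \<in> unit_cube" "Cn M X n \<omega> (s, t, u) = D \<omega> v + L * (C v - C u)"
    "\<And>j. \<bar>L * (v $ j - u $ j) + D \<omega> (uj v j)\<bar> \<le> 1 / sqrt (real n)"
proof -
  let ?S = "{a<..b}"
  have D: "D \<omega> x = (1 / sqrt (real n)) * (\<Sum>i\<in>?S. (if \<forall>j. U (int i) \<omega> $ j \<le> x $ j then 1 else 0) - C x)" for x
    unfolding D_def a_def b_def using Bt_increment[OF st] .
  obtain v where v: "v \<in> unit_cube"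
    and iff: "\<And>i j. i \<in> ?S \<Longrightarrow> real (rank X \<omega> (a + 1) b i j) / real (b - a) \<le> u $ j \<longleftrightarrow> U (int i) \<omega> $ j \<le> v $ j"
    and cnt: "\<And>j. \<bar>real (card {i\<in>?S. U (int i) \<omega> $ j \<le> v $ j}) - real (b - a) * u $ j\<bar> \<le> 1"
    using rank_threshold[OF g ab u] by blast
  have "Cn M X n \<omega> (s, t, u) = (1 / sqrt (real n)) *
      (\<Sum>i\<in>?S. (if \<forall>j. real (rank X \<omega> (a + 1) b i j) / real (b - a) \<le> u $ j then 1 else 0) - C u)"
    by (simp add: Cn_def Let_def a_def b_def)
  also have "(\<Sum>i\<in>?S. (if \<forall>j. real (rank X \<omega> (a + 1) b i j) / real (b - a) \<le> u $ j then 1 else 0) - C u) =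
      (\<Sum>i\<in>?S. ((if \<forall>j. U (int i) \<omega> $ j \<le> v $ j then 1 else 0) - C v) + (C v - C u))"
    using iff by (intro sum.cong refl) simp
  also have "\<dots> = (\<Sum>i\<in>?S. (if \<forall>j. U (int i) \<omega> $ j \<le> v $ j then 1 else 0) - C v) + real (b - a) * (C v - C u)"
    by (subst sum.distrib) simp
  finally have 1: "Cn M X n \<omega> (s, t, u) = D \<omega> v + L * (C v - C u)"
    unfolding D L_def by (simp add: distrib_left)
  have 2: "\<bar>L * (v $ j - u $ j) + D \<omega> (uj v j)\<bar> \<le> 1 / sqrt (real n)" for j
  proof -
    \<comment> \<open>All coordinates of \<open>uj v j\<close> other than \<open>j\<close> are 1 and
      impose no constraint, so the sum is a one-dimensional count centred at \<open>v $ j\<close>.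
      Its centring cancels against \<open>L * v $ j\<close>, leaving the count minus
      \<open>real (b - a) * u $ j\<close>.\<close>
    have "(\<Sum>i\<in>?S. (if \<forall>k. U (int i) \<omega> $ k \<le> uj v j $ k then 1 else 0) - C (uj v j)) =
        (\<Sum>i\<in>?S. (if U (int i) \<omega> $ j \<le> v $ j then 1 else 0) - v $ j)"
    proof (intro sum.cong refl)
      fix i
      have "(\<forall>k. U (int i) \<omega> $ k \<le> uj v j $ k) \<longleftrightarrow> U (int i) \<omega> $ j \<le> v $ j" using U_bounds by auto
      then show "(if \<forall>k. U (int i) \<omega> $ k \<le> uj v j $ k then 1 else 0) - C (uj v j) =
          (if U (int i) \<omega> $ j \<le> v $ j then 1 else 0) - v $ j" using copula_uj[OF v] by simp
    qed
    also have "\<dots> = real (card {i\<in>?S. U (int i) \<omega> $ j \<le> v $ j}) - real (b - a) * v $ j"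
      by (simp add: sum_subtractf sum.If_cases Int_def)
    finally have "L * (v $ j - u $ j) + D \<omega> (uj v j) =
        (real (card {i\<in>?S. U (int i) \<omega> $ j \<le> v $ j}) - real (b - a) * u $ j) / sqrt (real n)"
      unfolding D L_def by (simp only:) (simp add: diff_divide_distrib right_diff_distrib)
    also have "\<bar>\<dots>\<bar> \<le> 1 / sqrt (real n)"
      using cnt[of j] by (simp add: abs_divide divide_right_mono)
    finally show ?thesis .
  qed
  show ?thesis using that[OF v 1 2] .
qed

end

section \<open>Asymptotic equicontinuity and the approximation error\<close>

definition modulus :: "'t::metric_space set \<Rightarrow> real \<Rightarrow> ('t \<Rightarrow> real) \<Rightarrow> real" where
  "modulus T \<delta> x = (SUP (p, q)\<in>{(p, q). p \<in> T \<and> q \<in> T \<and> dist p q \<le> \<delta>}. \<bar>x p - x q\<bar>)"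

lemma modulus_le:
  assumes "T \<noteq> {}" "0 \<le> \<delta>" "\<And>p q. p \<in> T \<Longrightarrow> q \<in> T \<Longrightarrow> dist p q \<le> \<delta> \<Longrightarrow> \<bar>x p - x q\<bar> \<le> c"
  shows "modulus T \<delta> x \<le> c"
proof -
  obtain p where "p \<in> T" using assms(1) by auto
  then have "(p, p) \<in> {(p, q). p \<in> T \<and> q \<in> T \<and> dist p q \<le> \<delta>}" using assms(2) by simp
  then have "{(p, q). p \<in> T \<and> q \<in> T \<and> dist p q \<le> \<delta>} \<noteq> {}" by blast
  then show ?thesis unfolding modulus_def using assms(3) by (intro cSUP_least) auto
qed

lemma modulus_ge:
  assumes "in_linf T x" "p \<in> T" "q \<in> T" "dist p q \<le> \<delta>"
  shows "\<bar>x p - x q\<bar> \<le> modulus T \<delta> x"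
proof -
  obtain a where a: "\<And>t. t \<in> T \<Longrightarrow> \<bar>x t\<bar> \<le> a"
    using assms(1) unfolding in_linf_def bdd_above_def by auto
  have "\<bar>x p - x q\<bar> \<le> a + a" if "p \<in> T" "q \<in> T" for p q
    using a[OF that(1)] a[OF that(2)] by linarith
  then have "bdd_above ((\<lambda>(p, q). \<bar>x p - x q\<bar>) ` {(p, q). p \<in> T \<and> q \<in> T \<and> dist p q \<le> \<delta>})"
    by (auto intro!: bdd_aboveI)
  from cSUP_upper[OF _ this, of "(p, q)"] show ?thesis using assms by (simp add: modulus_def)
qed

lemma modulus_nonneg:
  assumes "T \<noteq> {}" "0 \<le> \<delta>" "in_linf T x" shows "0 \<le> modulus T \<delta> x"
proof -
  obtain p where "p \<in> T" using assms(1) by auto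
  from modulus_ge[OF assms(3) this this, of \<delta>] assms(2) show ?thesis by simp
qed

text \<open>Replacing \<open>x\<close> by \<open>y\<close> costs one supremum distance at each of
  the two evaluation points. The Lipschitz property makes the modulus accessible to weak convergence
  through truncation.\<close>

lemma modulus_lipschitz:
  assumes "T \<noteq> {}" "0 \<le> \<delta>" shows "linf_lipschitz T 2 (modulus T \<delta>)"
proof -
  have *: "modulus T \<delta> x \<le> modulus T \<delta> y + 2 * linf_dist T x y"
    if x: "in_linf T x" and y: "in_linf T y" for x y
  proof (rule modulus_le[OF assms])
    fix p q assume "p \<in> T" "q \<in> T" "dist p q \<le> \<delta>"
    then show "\<bar>x p - x q\<bar> \<le> modulus T \<delta> y + 2 * linf_dist T x y"
      using modulus_ge[OF y, of p q \<delta>] linf_dist_ge[OF x y, of p] linf_dist_ge[OF x y, of q] by linarith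
  qed
  show ?thesis unfolding linf_lipschitz_def
  proof (intro allI impI)
    fix x y assume "in_linf T x" "in_linf T y"
    then show "\<bar>modulus T \<delta> x - modulus T \<delta> y\<bar> \<le> 2 * linf_dist T x y"
      using *[of x y] *[of y x] linf_dist_commute[of T x y] by (simp add: abs_le_iff)
  qed
qed

lemma modulus_tendsto_0:
  assumes T: "compact T" "T \<noteq> {}" and x: "continuous_on T x" "in_linf T x"
  shows "(\<lambda>k. modulus T (1 / real (Suc k)) x) \<longlonglongrightarrow> 0"
proof (rule LIMSEQ_I)
  fix e :: real assume e: "0 < e"
  have "uniformly_continuous_on T x" using compact_uniformly_continuous[OF x(1) T(1)] .
  then obtain d where d: "d > 0" "\<And>p q. p \<in> T \<Longrightarrow> q \<in> T \<Longrightarrow> dist q p < d \<Longrightarrow> dist (x q) (x p) < e / 2"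
    unfolding uniformly_continuous_on_def using e by (meson half_gt_zero)
  obtain k0 where k0: "1 / real (Suc k0) < d" using nat_approx_posE[OF d(1)] by auto
  show "\<exists>no. \<forall>k\<ge>no. norm (modulus T (1 / real (Suc k)) x - 0) < e"
  proof (intro exI allI impI)
    fix k assume k: "k0 \<le> k"
    have "1 / real (Suc k) \<le> 1 / real (Suc k0)" using k by (intro divide_left_mono) auto
    then have kd: "1 / real (Suc k) < d" using k0 by linarith
    have "modulus T (1 / real (Suc k)) x \<le> e / 2"
    proof (rule modulus_le[OF T(2)])
      fix p q assume "p \<in> T" "q \<in> T" "dist p q \<le> 1 / real (Suc k)"
      then show "\<bar>x p - x q\<bar> \<le> e / 2" using d(2)[of q p] kd by (simp add: dist_real_def)
    qed simp
    moreover have "0 \<le> modulus T (1 / real (Suc k)) x" by (rule modulus_nonneg[OF T(2) _ x(2)]) simp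
    ultimately show "norm (modulus T (1 / real (Suc k)) x - 0) < e" using e by simp
  qed
qed

text \<open>Paths of the limit are bounded and almost surely uniformly continuous on the compact
  \<open>T\<close>, so dominated convergence provides a scale \<open>\<delta>\<close> and a bound
  \<open>R\<close> that fail with small probability in the limit. The tail lemma carries both over
  to the prelimit processes.\<close>

lemma hj_weak_conv_equicontinuous:
  assumes M: "prob_space M" and N: "prob_space N" and T: "compact T" "T \<noteq> {}"
    and conv: "hj_weak_conv M Xn N X T" and cont: "AE \<omega> in N. continuous_on T (X \<omega>)"
    and e: "0 < e" and \<eta>: "0 < \<eta>"
  shows "\<exists>\<delta>>0. \<exists>R\<ge>0. \<forall>\<^sub>F n in sequentially. \<exists>B\<in>sets M. measure M B < \<eta> \<and> (\<forall>\<omega>\<in>space M - B.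
    (\<forall>p\<in>T. \<bar>Xn n \<omega> p\<bar> \<le> R) \<and> (\<forall>p\<in>T. \<forall>q\<in>T. dist p q \<le> \<delta> \<longrightarrow> \<bar>Xn n \<omega> p - Xn n \<omega> q\<bar> \<le> e))"
proof -
  interpret N: prob_space N by fact
  interpret M: prob_space M by fact
  have Xb: "linf_borel N T X" using conv unfolding hj_weak_conv_def by auto
  then have inX: "in_linf T (X \<omega>)" if "\<omega> \<in> space N" for \<omega> using that unfolding linf_borel_def by auto
  have inXn: "in_linf T (Xn n \<omega>)" if "\<omega> \<in> space M" for n \<omega>
    using conv that unfolding hj_weak_conv_def by auto
  have in0: "in_linf T (\<lambda>_. 0)" by (auto simp: in_linf_def)
  have meas: "(\<lambda>\<omega>. min 1 (h (X \<omega>) / c)) \<in> borel_measurable N"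
    if h: "linf_lipschitz T L h" "0 \<le> L" "\<And>x. in_linf T x \<Longrightarrow> 0 \<le> h x" and c: "0 < c" for L h and c :: real
  proof -
    have "linf_lipschitz T (L / c) (\<lambda>x. min 1 (h x / c))"
      unfolding linf_lipschitz_def
    proof (intro allI impI)
      fix x y assume "in_linf T x" "in_linf T y"
      then have "\<bar>h x - h y\<bar> / c \<le> L * linf_dist T x y / c"
        using h(1) c unfolding linf_lipschitz_def by (intro divide_right_mono) auto
      moreover have "\<bar>h x - h y\<bar> / c = \<bar>h x / c - h y / c\<bar>" using c by (simp add: diff_divide_distrib[symmetric])
      ultimately show "\<bar>min 1 (h x / c) - min 1 (h y / c)\<bar> \<le> L / c * linf_dist T x y" by simp
    qed
    then have "linf_bcont T (\<lambda>x. min 1 (h x / c))"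
      by (rule linf_lipschitz_bcont[OF T(2), where K=1]) (use h c in auto)
    then show ?thesis using Xb unfolding linf_borel_def by auto
  qed
  let ?d = "\<lambda>k. 1 / real (Suc k)"
  have "(\<lambda>k. integral\<^sup>L N (\<lambda>\<omega>. min 1 (modulus T (?d k) (X \<omega>) / e))) \<longlonglongrightarrow> integral\<^sup>L N (\<lambda>_. 0)"
  proof (rule integral_dominated_convergence[where w="\<lambda>_. 1"])
    show "(\<lambda>\<omega>. min 1 (modulus T (?d k) (X \<omega>) / e)) \<in> borel_measurable N" for k
      using modulus_lipschitz[OF T(2), of "?d k"] modulus_nonneg[OF T(2), of "?d k"] e
      by (intro meas[OF modulus_lipschitz[OF T(2)]]) auto
    show "AE \<omega> in N. (\<lambda>k. min 1 (modulus T (?d k) (X \<omega>) / e)) \<longlonglongrightarrow> 0"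
      using cont AE_space
    proof eventually_elim
      case (elim \<omega>)
      from tendsto_min[OF tendsto_const[of 1] tendsto_divide[OF modulus_tendsto_0[OF T elim(1) inX[OF elim(2)]] tendsto_const[of e]]]
      show ?case using e by simp
    qed
    show "AE \<omega> in N. norm (min 1 (modulus T (?d k) (X \<omega>) / e)) \<le> 1" for k
      using AE_space
    proof eventually_elim
      case (elim \<omega>)
      then show ?case using modulus_nonneg[OF T(2) _ inX[OF elim], of "?d k"] e by simp
    qed
  qed auto
  then have "\<forall>\<^sub>F k in sequentially. integral\<^sup>L N (\<lambda>\<omega>. min 1 (modulus T (?d k) (X \<omega>) / e)) < \<eta> / 2"
    by (rule order_tendstoD(2)) (use \<eta> in simp)
  then obtain k where k: "integral\<^sup>L N (\<lambda>\<omega>. min 1 (modulus T (?d k) (X \<omega>) / e)) < \<eta> / 2"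
    by (auto simp: eventually_sequentially)
  \<comment> \<open>The supremum norm, written as a distance so that the triangle inequality gives
    its Lipschitz constant 1.\<close>
  let ?nrm = "\<lambda>x. linf_dist T x (\<lambda>_. 0)"
  have nrm_lip: "linf_lipschitz T 1 ?nrm"
    unfolding linf_lipschitz_def
  proof (intro allI impI)
    fix x y assume x: "in_linf T x" and y: "in_linf T y"
    show "\<bar>?nrm x - ?nrm y\<bar> \<le> 1 * linf_dist T x y"
      using linf_dist_triangle[OF T(2) x y in0] linf_dist_triangle[OF T(2) y x in0] linf_dist_commute[of T x y]
      by (simp add: abs_le_iff)
  qed
  have nrm_nonneg: "0 \<le> ?nrm x" if "in_linf T x" for x using linf_dist_nonneg[OF T(2) that in0] .
  \<comment> \<open>Each limit path has finite norm, hence the truncated ratio tends to 0 pointwise;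
    the index found below gives the bound \<open>R\<close>.\<close>
  have "(\<lambda>k. integral\<^sup>L N (\<lambda>\<omega>. min 1 (?nrm (X \<omega>) / real (Suc k)))) \<longlonglongrightarrow> integral\<^sup>L N (\<lambda>_. 0)"
  proof (rule integral_dominated_convergence[where w="\<lambda>_. 1"])
    show "(\<lambda>\<omega>. min 1 (?nrm (X \<omega>) / real (Suc k))) \<in> borel_measurable N" for k
      using nrm_nonneg by (intro meas[OF nrm_lip]) auto
    show "AE \<omega> in N. (\<lambda>k. min 1 (?nrm (X \<omega>) / real (Suc k))) \<longlonglongrightarrow> 0"
    proof (rule AE_I2)
      fix \<omega>
      from tendsto_min[OF tendsto_const[of 1] tendsto_mult[OF tendsto_const[of "?nrm (X \<omega>)"] LIMSEQ_inverse_real_of_nat]]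
      show "(\<lambda>k. min 1 (?nrm (X \<omega>) / real (Suc k))) \<longlonglongrightarrow> 0" by (simp add: divide_inverse)
    qed
    show "AE \<omega> in N. norm (min 1 (?nrm (X \<omega>) / real (Suc k))) \<le> 1" for k
      using nrm_nonneg[OF inX] by auto
  qed auto
  then have "\<forall>\<^sub>F k in sequentially. integral\<^sup>L N (\<lambda>\<omega>. min 1 (?nrm (X \<omega>) / real (Suc k))) < \<eta> / 2"
    by (rule order_tendstoD(2)) (use \<eta> in simp)
  then obtain m where m: "integral\<^sup>L N (\<lambda>\<omega>. min 1 (?nrm (X \<omega>) / real (Suc m))) < \<eta> / 2"
    by (auto simp: eventually_sequentially)
  \<comment> \<open>Modulus and norm each receive half of the allowance \<open>\<eta>\<close>; their
    exceptional sets are united afterwards.\<close>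
  have ev1: "\<forall>\<^sub>F n in sequentially. \<exists>B\<in>sets M. measure M B < \<eta> / 2 \<and> (\<forall>\<omega>\<in>space M - B. modulus T (?d k) (Xn n \<omega>) < e)"
  proof (rule hj_weak_conv_tail[where h="modulus T (?d k)" and L=2, OF M T(2) conv])
    show "linf_lipschitz T 2 (modulus T (?d k))" by (rule modulus_lipschitz[OF T(2)]) simp
    show "0 \<le> modulus T (?d k) x" if "in_linf T x" for x by (rule modulus_nonneg[OF T(2) _ that]) simp
  qed (use e k in auto)
  have ev2: "\<forall>\<^sub>F n in sequentially. \<exists>B\<in>sets M. measure M B < \<eta> / 2 \<and> (\<forall>\<omega>\<in>space M - B. ?nrm (Xn n \<omega>) < real (Suc m))"
    by (rule hj_weak_conv_tail[where h="?nrm" and L=1, OF M T(2) conv nrm_lip]) (use nrm_nonneg m in auto)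
  from ev1 ev2 have "\<forall>\<^sub>F n in sequentially. \<exists>B\<in>sets M. measure M B < \<eta> \<and> (\<forall>\<omega>\<in>space M - B.
    (\<forall>p\<in>T. \<bar>Xn n \<omega> p\<bar> \<le> real (Suc m)) \<and> (\<forall>p\<in>T. \<forall>q\<in>T. dist p q \<le> ?d k \<longrightarrow> \<bar>Xn n \<omega> p - Xn n \<omega> q\<bar> \<le> e))"
  proof eventually_elim
    case (elim n)
    then obtain B1 B2 where B: "B1 \<in> sets M" "B2 \<in> sets M" "measure M B1 < \<eta> / 2" "measure M B2 < \<eta> / 2"
      and B1: "\<And>\<omega>. \<omega> \<in> space M - B1 \<Longrightarrow> modulus T (?d k) (Xn n \<omega>) < e"
      and B2: "\<And>\<omega>. \<omega> \<in> space M - B2 \<Longrightarrow> ?nrm (Xn n \<omega>) < real (Suc m)" by metis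
    show ?case
    proof (intro bexI[of _ "B1 \<union> B2"] conjI ballI impI)
      show "measure M (B1 \<union> B2) < \<eta>" using measure_Un_le[OF B(1,2)] B(3,4) by linarith
      fix \<omega> assume w: "\<omega> \<in> space M - (B1 \<union> B2)"
      then have inw: "in_linf T (Xn n \<omega>)" using inXn by auto
      fix p assume p: "p \<in> T"
      show "\<bar>Xn n \<omega> p\<bar> \<le> real (Suc m)"
        using linf_dist_ge[OF inw in0 p] B2[of \<omega>] w by simp
      fix q assume "q \<in> T" "dist p q \<le> ?d k"
      then show "\<bar>Xn n \<omega> p - Xn n \<omega> q\<bar> \<le> e"
        using modulus_ge[OF inw p] B1[of \<omega>] w by fastforce
    qed (use B in auto)
  qed
  then show ?thesis by (intro exI[of _ "?d k"] conjI exI[of _ "real (Suc m)"]) auto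
qed

section \<open>The index sets and the Lipschitz map to the approximating process\<close>

lemma compact_T1: "compact (T1 :: (real \<times> (real^'d)) set)"
  unfolding T1_def by (intro compact_Times compact_Icc compact_unit_cube)

lemma T1_nonempty: "(T1 :: (real \<times> (real^'d)) set) \<noteq> {}"
  using one_in_unit_cube by (auto simp: T1_def)

lemma Delta_cube_nonempty: "(Delta_cube :: (real \<times> real \<times> (real^'d)) set) \<noteq> {}"
proof -
  have "(0, 0, \<chi> j. 1) \<in> (Delta_cube :: (real \<times> real \<times> (real^'d)) set)"
    using one_in_unit_cube by (simp add: Delta_cube_def)
  then show ?thesis by blast
qed

context smooth_copula begin

text \<open>\<open>approx_proc\<close> is linear in the process. Each time increment changes by at
  most \<open>2 * c\<close>; there is one increment at \<open>u\<close> and one for each of the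
  \<open>CARD('d)\<close> points \<open>uj u j\<close>, the latter weighted by partial derivatives
  bounded by 1.\<close>

lemma approx_proc_diff_le:
  assumes "\<And>p. p \<in> T1 \<Longrightarrow> \<bar>x p - y p\<bar> \<le> c" "p \<in> Delta_cube"
  shows "\<bar>approx_proc C x p - approx_proc C y p\<bar> \<le> (2 + 2 * real CARD('d)) * c"
proof -
  obtain s t u where p: "p = (s, t, u)" "0 \<le> s" "s \<le> t" "t \<le> 1" "u \<in> unit_cube"
    using assms(2) by (auto simp: Delta_cube_def)
  have z: "\<bar>(x (t, v) - x (s, v)) - (y (t, v) - y (s, v))\<bar> \<le> 2 * c" if "v \<in> unit_cube" for v
    using assms(1)[of "(t, v)"] assms(1)[of "(s, v)"] that p by (auto simp: T1_def)
  let ?z = "\<lambda>v. (x (t, v) - x (s, v)) - (y (t, v) - y (s, v))"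
  have "\<bar>\<Sum>j\<in>UNIV. Cdot C j u * ?z (uj u j)\<bar> \<le> (\<Sum>j\<in>(UNIV::'d set). 2 * c)"
  proof (rule order_trans[OF sum_abs sum_mono])
    fix j
    have "\<bar>Cdot C j u * ?z (uj u j)\<bar> \<le> 1 * (2 * c)"
      unfolding abs_mult
      using Cdot_abs_le[OF p(5), of j] z[OF uj_in_unit_cube[OF p(5)], of j] by (intro mult_mono) auto
    then show "\<bar>Cdot C j u * ?z (uj u j)\<bar> \<le> 2 * c" by simp
  qed
  moreover have "approx_proc C x p - approx_proc C y p = ?z u - (\<Sum>j\<in>UNIV. Cdot C j u * ?z (uj u j))"
    unfolding p approx_proc_def by (simp add: sum_subtractf right_diff_distrib)
  ultimately show ?thesis using z[OF p(5)] by (simp add: algebra_simps)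
qed

lemma approx_proc_in_linf:
  assumes "in_linf T1 x" shows "in_linf Delta_cube (approx_proc C x)"
proof -
  obtain c where "\<And>p. p \<in> T1 \<Longrightarrow> \<bar>x p - 0\<bar> \<le> c"
    using assms unfolding in_linf_def bdd_above_def by auto
  from approx_proc_diff_le[of x "\<lambda>_. 0" c] this
  have "\<bar>approx_proc C x p - approx_proc C (\<lambda>_. 0) p\<bar> \<le> (2 + 2 * real CARD('d)) * c" if "p \<in> Delta_cube" for p
    using that by blast
  moreover have "approx_proc C (\<lambda>_. 0) p = 0" for p by (simp add: approx_proc_def split: prod.split)
  ultimately show ?thesis unfolding in_linf_def by (auto intro!: bdd_aboveI)
qed

lemma approx_proc_lipschitz:
  assumes "in_linf T1 x" "in_linf T1 y"
  shows "linf_dist Delta_cube (approx_proc C x) (approx_proc C y) \<le> (2 + 2 * real CARD('d)) * linf_dist T1 x y"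
  using approx_proc_diff_le[OF linf_dist_ge[OF assms]] by (intro linf_dist_le[OF Delta_cube_nonempty]) auto

end

lemma nat_floor_mult_le: "t \<le> 1 \<Longrightarrow> nat \<lfloor>real n * t\<rfloor> \<le> n" for t :: real
proof -
  assume "t \<le> 1"
  then have "real n * t \<le> real n * 1" by (intro mult_left_mono) auto
  then show ?thesis by (simp add: nat_le_iff floor_le_iff)
qed

lemma dist_uj_le:
  fixes u v :: "real^'d" shows "dist (uj u j) (uj v j) \<le> \<bar>u $ j - v $ j\<bar>"
proof -
  have "(\<Sum>k\<in>UNIV. \<bar>(uj u j - uj v j) $ k\<bar>) = (\<Sum>k\<in>UNIV. if k = j then \<bar>u $ j - v $ j\<bar> else 0)"
    by (intro sum.cong) auto
  then show ?thesis using norm_le_l1_cart[of "uj u j - uj v j"] by (simp add: dist_norm)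
qed

context stationary_sample begin

text \<open>On regular outcomes no transformed value is 0, so every indicator vanishes along with
  \<open>C x\<close>. The prelimit process thus has the exact boundary value needed for
  \<open>u $ j\<close> near 0.\<close>

lemma Bt_zero:
  assumes "regular \<omega>" "x $ j = 0" shows "Bt M X n \<omega> (s, x) = 0"
proof -
  have "\<not> (\<forall>k. U (int i) \<omega> $ k \<le> x $ k)" for i
    using assms unfolding regular_def by (metis not_le)
  then show ?thesis using copula_zero[OF assms(2)] by (auto simp: Bt_def intro!: sum.neutral)
qed

lemma Bt_one: "Bt M X n \<omega> (s, \<chi> j. 1) = 0"
  using U_bounds copula_one by (simp add: Bt_def)

text \<open>At most \<open>n\<close> summands of size at most 1: crude, but boundedness is needed
  only for each fixed \<open>n\<close>.\<close>

lemma Cn_in_linf: "in_linf Delta_cube (Cn M X n \<omega>)"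
proof -
  have "\<bar>Cn M X n \<omega> p\<bar> \<le> real n / sqrt (real n)" if pD: "p \<in> Delta_cube" for p :: "real \<times> real \<times> (real^'d)"
  proof -
    obtain s t u where p: "p = (s, t, u)" "0 \<le> s" "s \<le> t" "t \<le> 1"
      using pD by (auto simp: Delta_cube_def)
    let ?a = "nat \<lfloor>real n * s\<rfloor>" and ?b = "nat \<lfloor>real n * t\<rfloor>"
    have bn: "?b \<le> n" using nat_floor_mult_le[OF p(4)] .
    let ?S = "\<Sum>i\<in>{?a<..?b}. (if \<forall>j. real (rank X \<omega> (?a + 1) ?b i j) / real (?b - ?a) \<le> u $ j then 1 else 0) - C u"
    have "\<bar>(if P then 1 else 0) - C u\<bar> \<le> 1" for P using copula_bounds[of u] by simp
    then have "\<bar>?S\<bar> \<le> (\<Sum>i\<in>{?a<..?b}. 1)" by (intro order_trans[OF sum_abs sum_mono])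
    also have "\<dots> \<le> real n" using bn by simp
    finally have "\<bar>?S\<bar> / sqrt (real n) \<le> real n / sqrt (real n)" by (rule divide_right_mono) simp
    moreover have "Cn M X n \<omega> p = (1 / sqrt (real n)) * ?S" by (simp add: p(1) Cn_def Let_def)
    ultimately show ?thesis by (simp only: abs_mult) simp
  qed
  then show ?thesis unfolding in_linf_def by (rule bdd_aboveI2)
qed

end

locale smooth_sample = stationary_sample M X + smooth_copula "copula M X"
  for M :: "'a measure" and X :: "int \<Rightarrow> 'a \<Rightarrow> real^'d::finite"
begin

text \<open>The deterministic core. The threshold for \<open>n\<close> does not depend on \<omega>,
  so the bound holds at once on the whole event where paths are regular, bounded and equicontinuous.
  In the constant, \<open>2 * e\<close> pays for replacing \<open>D v\<close> by \<open>D u\<close>,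
  and \<open>9 * real CARD('d) * e\<close> is the expansion bound at level
  \<open>3 * e\<close>.\<close>

lemma approx_error:
  assumes e: "0 < e" and \<delta>: "0 < \<delta>" and R: "0 \<le> R"
  shows "\<forall>\<^sub>F n in sequentially. \<forall>\<omega>. regular \<omega> \<longrightarrow> (\<forall>p\<in>T1. \<bar>Bt M X n \<omega> p\<bar> \<le> R) \<longrightarrow>
    (\<forall>p\<in>T1. \<forall>q\<in>T1. dist p q \<le> \<delta> \<longrightarrow> \<bar>Bt M X n \<omega> p - Bt M X n \<omega> q\<bar> \<le> e) \<longrightarrow>
    (\<forall>p\<in>Delta_cube. \<bar>Cn M X n \<omega> p - approx_proc C (Bt M X n \<omega>) p\<bar> \<le> (2 + 9 * real CARD('d)) * e)"
proof -
  let ?d = "real CARD('d)"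
  \<comment> \<open>Boundary bands of width at most \<open>\<delta>\<close>, so that equicontinuity
    reaches the face; the cap 1/2 keeps the middle band nonempty.\<close>
  define \<eta> where "\<eta> = min \<delta> (1 / 2)"
  have \<eta>: "0 < \<eta>" "\<eta> \<le> \<delta>" using \<delta> by (auto simp: \<eta>_def)
  \<comment> \<open>The derivative will be multiplied by an increment of size at most
    \<open>2 * R\<close>, so this tolerance makes the product at most \<open>e\<close>.\<close>
  obtain \<rho> where \<rho>: "\<rho> > 0" "\<And>j u w. u \<in> unit_cube \<Longrightarrow> w \<in> unit_cube \<Longrightarrow> \<eta> \<le> u $ j \<Longrightarrow> u $ j \<le> 1 - \<eta> \<Longrightarrow>
      dist w u < \<rho> \<Longrightarrow> \<bar>Cdot C j w - Cdot C j u\<bar> < e / (2 * R + 1)"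
    using Cdot_uniform[OF \<eta>(1), of "e / (2 * R + 1)"] e R by (auto simp: divide_pos_pos)
  define \<tau> where "\<tau> = min \<rho> \<delta> / 2"
  have \<tau>: "0 < \<tau>" "\<tau> < \<rho>" "\<tau> \<le> \<delta>" using \<rho>(1) \<delta> by (auto simp: \<tau>_def)
  have inv0: "(\<lambda>n. c * (1 / sqrt (real n))) \<longlonglongrightarrow> 0" for c :: real
  proof -
    have "(\<lambda>n. 1 / sqrt (real n)) \<longlonglongrightarrow> 0"
      by (intro tendsto_divide_0[OF tendsto_const] filterlim_at_top_imp_at_infinity
          filterlim_compose[OF sqrt_at_top] filterlim_real_sequentially)
    from tendsto_mult_right_zero[OF this] show ?thesis .
  qed
  have "\<forall>\<^sub>F n in sequentially. 1 * (1 / sqrt (real n)) < min e 1"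
    by (rule order_tendstoD(2)[OF inv0]) (use e in simp)
  \<comment> \<open>The left side is the bound for the distance between \<open>v\<close> and
    \<open>u\<close> on long blocks, obtained further below.\<close>
  moreover have "\<forall>\<^sub>F n in sequentially. (?d * (2 * R + 1) / \<delta>) * (1 / sqrt (real n)) < \<tau>"
    by (rule order_tendstoD(2)[OF inv0 \<tau>(1)])
  ultimately show ?thesis using eventually_gt_at_top[of 0]
  proof eventually_elim
    case (elim n)
    have n: "0 < n" "1 / sqrt (real n) \<le> e" "1 / sqrt (real n) \<le> 1" using elim by auto
    show ?case
    proof (intro allI impI ballI)
      fix \<omega> and p :: "real \<times> real \<times> (real^'d)"
      assume g: "regular \<omega>" and bd: "\<forall>p\<in>T1. \<bar>Bt M X n \<omega> p\<bar> \<le> R"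
        and eq: "\<forall>p\<in>T1. \<forall>q\<in>T1. dist p q \<le> \<delta> \<longrightarrow> \<bar>Bt M X n \<omega> p - Bt M X n \<omega> q\<bar> \<le> e"
        and "p \<in> Delta_cube"
      then obtain s t u where p: "p = (s, t, u)" "0 \<le> s" "s \<le> t" "t \<le> 1" and u: "u \<in> unit_cube"
        by (auto simp: Delta_cube_def)
      define a b where "a = nat \<lfloor>real n * s\<rfloor>" and "b = nat \<lfloor>real n * t\<rfloor>"
      define D where "D x = Bt M X n \<omega> (t, x) - Bt M X n \<omega> (s, x)" for x
      define L where "L = real (b - a) / sqrt (real n)"
      have L0: "0 \<le> L" by (simp add: L_def)
      have approx: "approx_proc C (Bt M X n \<omega>) p = D u - (\<Sum>j\<in>UNIV. Cdot C j u * D (uj u j))"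
        by (simp add: p(1) approx_proc_def D_def)
      have ab: "a \<le> b" unfolding a_def b_def using p by (intro nat_mono floor_mono mult_left_mono) auto
      show "\<bar>Cn M X n \<omega> p - approx_proc C (Bt M X n \<omega>) p\<bar> \<le> (2 + 9 * ?d) * e"
      proof (cases "a = b")
        case True
        have "Cn M X n \<omega> p = 0" using True by (simp add: p(1) Cn_def Let_def a_def b_def)
        moreover have "D x = 0" for x using True by (simp add: D_def Bt_def a_def b_def)
        ultimately show ?thesis using e unfolding approx by simp
      next
        case False
        then have lt: "a < b" using ab by simp
        obtain v where v: "v \<in> unit_cube" and Cn: "Cn M X n \<omega> p = D v + L * (C v - C u)"
          and inc: "\<And>j. \<bar>L * (v $ j - u $ j) + D (uj v j)\<bar> \<le> 1 / sqrt (real n)"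
          using Cn_representation[OF g p(3) lt[unfolded a_def b_def] u]
          unfolding p(1) D_def L_def a_def b_def by blast
        have st01: "t \<in> {0..1}" "s \<in> {0..1}" using p by auto
        have D_bd: "\<bar>D x\<bar> \<le> 2 * R" if "x \<in> unit_cube" for x
          using bd[rule_format, of "(t, x)"] bd[rule_format, of "(s, x)"] that st01
          unfolding D_def T1_def by auto
        have D_eq: "\<bar>D x - D y\<bar> \<le> 2 * e" if "x \<in> unit_cube" "y \<in> unit_cube" "dist x y \<le> \<delta>" for x y
          using eq[rule_format, of "(t, x)" "(t, y)"] eq[rule_format, of "(s, x)" "(s, y)"] that st01
          unfolding D_def T1_def by (auto simp: dist_Pair_Pair)
        have vj: "0 \<le> v $ j" "v $ j \<le> 1" "0 \<le> u $ j" "u $ j \<le> 1" for j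
          using u v by (auto simp: unit_cube_def)
        have Dvu: "\<bar>D v - D u\<bar> \<le> 2 * e \<and> (\<forall>j. \<bar>D (uj v j) - D (uj u j)\<bar> \<le> 2 * e) \<and>
          (\<forall>j. \<bar>D (uj u j)\<bar> \<le> 3 * e \<or> (\<forall>w\<in>unit_cube. (\<forall>k. \<bar>w $ k - u $ k\<bar> \<le> \<bar>v $ k - u $ k\<bar>) \<longrightarrow>
                \<bar>Cdot C j w - Cdot C j u\<bar> * \<bar>D (uj u j)\<bar> \<le> 3 * e))"
        proof (cases "real (b - a) \<le> real n * \<delta>")
          case True
          have bn: "b \<le> n"
            unfolding b_def by (rule nat_floor_mult_le[OF p(4)])
          have D_small: "\<bar>D x\<bar> \<le> e" if "x \<in> unit_cube" for x
          proof -
            \<comment> \<open>The process depends on time only through the integer part, so the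
              times may be moved to grid points. There the distance is exactly the block length over
              \<open>n\<close>, without the rounding that separates it from
              \<open>t - s\<close>.\<close>
            have "D x = Bt M X n \<omega> (real b / real n, x) - Bt M X n \<omega> (real a / real n, x)"
              using n(1) by (simp add: D_def Bt_def a_def b_def)
            also have "\<bar>\<dots>\<bar> \<le> e"
            proof (rule eq[rule_format])
              show "(real b / real n, x) \<in> T1" "(real a / real n, x) \<in> T1"
                using that bn ab n(1) by (auto simp: T1_def)
              have "dist (real b / real n, x) (real a / real n, x) = real (b - a) / real n"
                using ab by (simp add: dist_Pair_Pair dist_real_def diff_divide_distrib[symmetric] of_nat_diff)
              then show "dist (real b / real n, x) (real a / real n, x) \<le> \<delta>"
                using True n(1) by (simp add: pos_divide_le_eq mult.commute)
            qed
            finally show ?thesis .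
          qed
          have "\<bar>D x - D y\<bar> \<le> 2 * e" if "x \<in> unit_cube" "y \<in> unit_cube" for x y
            using D_small[OF that(1)] D_small[OF that(2)] by linarith
          moreover have "\<bar>D (uj u j)\<bar> \<le> 3 * e" for j
            using D_small[OF uj_in_unit_cube[OF u], of j] e by linarith
          ultimately show ?thesis using u v uj_in_unit_cube by blast
        next
          case False
          have sn: "0 < sqrt (real n)" using n(1) by simp
          have "\<delta> * sqrt (real n) = real n * \<delta> / sqrt (real n)"
            using n(1) by (simp add: real_div_sqrt field_simps)
          also have "\<dots> \<le> L" unfolding L_def using False by (intro divide_right_mono) auto
          \<comment> \<open>On a long block \<open>L\<close> grows like
            \<open>sqrt (real n)\<close>, so dividing the bounded quantity
            \<open>L * (v $ j - u $ j)\<close> by it forces \<open>v\<close> towards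
            \<open>u\<close>.\<close>
          finally have Lge: "\<delta> * sqrt (real n) \<le> L" .
          have close: "\<bar>v $ j - u $ j\<bar> \<le> (2 * R + 1) / \<delta> * (1 / sqrt (real n))" for j
          proof -
            have "\<delta> * sqrt (real n) * \<bar>v $ j - u $ j\<bar> \<le> L * \<bar>v $ j - u $ j\<bar>"
              using Lge by (intro mult_right_mono) auto
            also have "\<dots> = \<bar>L * (v $ j - u $ j)\<bar>" using L0 by (simp add: abs_mult)
            also have "\<dots> \<le> 2 * R + 1"
              using inc[of j] D_bd[OF uj_in_unit_cube[OF v], of j] n(3) by linarith
            finally show ?thesis using \<delta> sn by (simp add: field_simps)
          qed
          have dist: "dist w u \<le> \<tau>" if "\<And>k. \<bar>w $ k - u $ k\<bar> \<le> \<bar>v $ k - u $ k\<bar>" for w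
          proof -
            have "dist w u \<le> ?d * ((2 * R + 1) / \<delta> * (1 / sqrt (real n)))"
              by (rule dist_vec_le) (rule order_trans[OF that close])
            then show ?thesis using elim(2) by simp
          qed
          have "dist (uj v j) (uj u j) \<le> \<delta>" for j
          proof -
            have "\<bar>v $ j - u $ j\<bar> \<le> dist v u" using dist_vec_nth_le[of v j u] by (simp add: dist_real_def)
            then show ?thesis using dist_uj_le[of v j u] dist[of v] \<tau> by simp
          qed
          moreover have "dist v u \<le> \<delta>" using dist[of v] \<tau> by simp
          moreover have "\<bar>D (uj u j)\<bar> \<le> 3 * e \<or> (\<forall>w\<in>unit_cube. (\<forall>k. \<bar>w $ k - u $ k\<bar> \<le> \<bar>v $ k - u $ k\<bar>) \<longrightarrow>
                \<bar>Cdot C j w - Cdot C j u\<bar> * \<bar>D (uj u j)\<bar> \<le> 3 * e)" for j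
          proof -
            consider "u $ j < \<eta>" | "u $ j > 1 - \<eta>" | "\<eta> \<le> u $ j" "u $ j \<le> 1 - \<eta>" by linarith
            then show ?thesis
            proof cases
              case 1
              \<comment> \<open>The projection of \<open>uj u j\<close> onto the face where
                coordinate \<open>j\<close> is 0.\<close>
              let ?x = "uj (upd u j 0) j"
              have x: "?x \<in> unit_cube" by (intro uj_in_unit_cube upd_in_unit_cube u) auto
              have "dist (uj u j) ?x \<le> \<delta>" using dist_uj_le[of u j "upd u j 0"] 1 \<eta> vj[of j] by simp
              moreover have "D ?x = 0" unfolding D_def using Bt_zero[OF g, of ?x j] by simp
              ultimately have "\<bar>D (uj u j)\<bar> \<le> 2 * e" using D_eq[OF uj_in_unit_cube[OF u] x] by simp
              then show ?thesis using e by linarith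
            next
              case 2
              \<comment> \<open>Raising coordinate \<open>j\<close> of \<open>uj u j\<close> to 1
                gives the all-ones vector, where the process vanishes.\<close>
              let ?x = "(\<chi> k. 1) :: real^'d"
              have "uj ?x j = ?x" by (simp add: vec_eq_iff)
              then have "dist (uj u j) ?x \<le> \<delta>" using dist_uj_le[of u j ?x] 2 \<eta> vj[of j] by simp
              moreover have "D ?x = 0" unfolding D_def by (simp add: Bt_one)
              ultimately have "\<bar>D (uj u j)\<bar> \<le> 2 * e"
                using D_eq[OF uj_in_unit_cube[OF u] one_in_unit_cube] by simp
              then show ?thesis using e by linarith
            next
              case 3
              have "\<bar>Cdot C j w - Cdot C j u\<bar> * \<bar>D (uj u j)\<bar> \<le> 3 * e"
                if w: "w \<in> unit_cube" "\<forall>k. \<bar>w $ k - u $ k\<bar> \<le> \<bar>v $ k - u $ k\<bar>" for w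
              proof -
                have "\<bar>Cdot C j w - Cdot C j u\<bar> \<le> e / (2 * R + 1)"
                  using \<rho>(2)[OF u w(1) 3] dist[of w] w(2) \<tau>(2) by auto
                then have "\<bar>Cdot C j w - Cdot C j u\<bar> * \<bar>D (uj u j)\<bar> \<le> e / (2 * R + 1) * (2 * R + 1)"
                  using D_bd[OF uj_in_unit_cube[OF u], of j] e R by (intro mult_mono) auto
                also have "\<dots> = e" using R by simp
                finally show ?thesis using e by linarith
              qed
              then show ?thesis by blast
            qed
          qed
          ultimately show ?thesis
            using D_eq[OF v u] D_eq[OF uj_in_unit_cube[OF v] uj_in_unit_cube[OF u]] by blast
        qed
        have "\<bar>L * (C v - C u) + (\<Sum>j\<in>UNIV. Cdot C j u * D (uj u j))\<bar> \<le> 3 * ?d * (3 * e)"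
        proof (rule expansion_bound[OF u v L0])
          \<comment> \<open>The margin identity holds at \<open>uj v j\<close> with error at most
            \<open>e\<close>; moving to \<open>uj u j\<close> adds \<open>2 * e\<close>, whence the
            level \<open>3 * e\<close>.\<close>
          show "\<bar>L * (v $ j - u $ j) + D (uj u j)\<bar> \<le> 3 * e" for j
          proof -
            have "\<bar>D (uj v j) - D (uj u j)\<bar> \<le> 2 * e" using Dvu by blast
            then show ?thesis using inc[of j] n(2) by linarith
          qed
        qed (use Dvu in blast)
        moreover have "Cn M X n \<omega> p - approx_proc C (Bt M X n \<omega>) p =
            (D v - D u) + (L * (C v - C u) + (\<Sum>j\<in>UNIV. Cdot C j u * D (uj u j)))"
          unfolding Cn approx by simp
        moreover have "\<bar>D v - D u\<bar> \<le> 2 * e" using Dvu by blast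
        moreover have "(2 + 9 * ?d) * e = 2 * e + 3 * ?d * (3 * e)" by (simp add: algebra_simps)
        ultimately show ?thesis by linarith
      qed
    qed
  qed
qed

end

section \<open>Convergence in probability and weak convergence of the empirical copula
  process\<close>

theorem theorem3p4:
  fixes M :: "'a measure" and X :: "int \<Rightarrow> 'a \<Rightarrow> real^'d::finite"
    and N :: "'b measure" and BC :: "'b \<Rightarrow> real \<times> (real^'d) \<Rightarrow> real"
  assumes M: "prob_space M"
    and X_rv: "\<forall>i. X i \<in> borel_measurable M"
    and X_stat: "strictly_stationary M X"
    and margins_cont: "\<forall>j. continuous_on UNIV (margin M X j)"
    and U_stat: "strictly_stationary M (Upit M X)"
    and N: "prob_space N"
    and BC_gauss: "centered_gaussian N T1 BC"
    and BC_borel: "linf_borel N T1 BC"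
    and BC_tight: "linf_tight N T1 BC"
    and BC_conc: "AE \<omega> in N. continuous_on T1 (BC \<omega>) \<and>
                   (\<forall>s u. (s, u) \<in> T1 \<and> (s = 0 \<or> (\<exists>j. u $ j = 0)) \<longrightarrow> BC \<omega> (s, u) = 0) \<and>
                   (\<forall>s. 0 < s \<and> s \<le> 1 \<longrightarrow> BC \<omega> (s, \<chi> j. 1) = 0)"
    and Bt_conv: "hj_weak_conv M (Bt M X) N BC T1"
    and C_diff: "\<forall>j. \<forall>u\<in>unit_cube. 0 < u $ j \<and> u $ j < 1 \<longrightarrow>
                   (\<lambda>x. copula M X (upd u j x)) differentiable (at (u $ j))"
    and C_cont: "\<forall>j. continuous_on {u\<in>unit_cube. 0 < u $ j \<and> u $ j < 1} (Cdot (copula M X) j)"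
    and no_ties: "\<forall>n j. AE \<omega> in M. inj_on (\<lambda>i. X (int i) \<omega> $ j) {1..n}"
  shows "(\<forall>e>0. (\<lambda>n. outer_prob M {\<omega>\<in>space M.
             (SUP p\<in>Delta_cube. \<bar>Cn M X n \<omega> p - approx_proc (copula M X) (Bt M X n \<omega>) p\<bar>) > e})
           \<longlonglongrightarrow> 0)
       \<and> hj_weak_conv M (Cn M X) N (\<lambda>\<omega>. approx_proc (copula M X) (BC \<omega>)) Delta_cube"
proof -
  interpret stationary_sample M X
    using M X_rv X_stat margins_cont by (simp add: stationary_sample_def stationary_sample_axioms_def)
  interpret smooth_sample M X
    by unfold_locales (use copula_lip C_diff C_cont in auto)
  let ?A = "\<lambda>n \<omega>. approx_proc C (Bt M X n \<omega>)"
  have close: "\<forall>\<^sub>F n in sequentially. \<exists>B\<in>sets M. measure M B < \<eta> \<and>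
      (\<forall>\<omega>\<in>space M - B. linf_dist Delta_cube (Cn M X n \<omega>) (?A n \<omega>) \<le> e)" if e: "0 < e" and \<eta>: "0 < \<eta>" for e \<eta>
  proof -
    \<comment> \<open>Scaled so that the constant of the deterministic error bound returns exactly
      \<open>e\<close>.\<close>
    define h where "h = e / (2 + 9 * real CARD('d))"
    have pos: "0 < 2 + 9 * real CARD('d)" by (simp add: add_pos_nonneg)
    have h: "0 < h" "(2 + 9 * real CARD('d)) * h = e" using e pos by (simp_all add: h_def)
    have "AE \<omega> in N. continuous_on T1 (BC \<omega>)" using BC_conc by eventually_elim simp
    from hj_weak_conv_equicontinuous[OF M N compact_T1 T1_nonempty Bt_conv this h(1) \<eta>]
    obtain \<delta> R where \<delta>: "0 < \<delta>" "0 \<le> R"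
      and ev: "\<forall>\<^sub>F n in sequentially. \<exists>B\<in>sets M. measure M B < \<eta> \<and> (\<forall>\<omega>\<in>space M - B.
        (\<forall>p\<in>T1. \<bar>Bt M X n \<omega> p\<bar> \<le> R) \<and> (\<forall>p\<in>T1. \<forall>q\<in>T1. dist p q \<le> \<delta> \<longrightarrow> \<bar>Bt M X n \<omega> p - Bt M X n \<omega> q\<bar> \<le> h))"
      by blast
    have "AE \<omega> in M. regular \<omega>" by (rule AE_regular) (use no_ties in blast)
    \<comment> \<open>The set of irregular outcomes is only known to lie inside a null set; the
      measurable \<open>Z\<close> is added to the exceptional set without changing its
      measure.\<close>
    then obtain Z where Z: "Z \<in> null_sets M" and Zg: "{\<omega>\<in>space M. \<not> regular \<omega>} \<subseteq> Z"
      unfolding eventually_ae_filter by blast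
    from ev approx_error[OF h(1) \<delta>] show ?thesis
    proof eventually_elim
      case (elim n)
      from elim(1) obtain B where B: "B \<in> sets M" "measure M B < \<eta>"
        and Bd: "\<And>\<omega>. \<omega> \<in> space M - B \<Longrightarrow> (\<forall>p\<in>T1. \<bar>Bt M X n \<omega> p\<bar> \<le> R) \<and>
           (\<forall>p\<in>T1. \<forall>q\<in>T1. dist p q \<le> \<delta> \<longrightarrow> \<bar>Bt M X n \<omega> p - Bt M X n \<omega> q\<bar> \<le> h)" by blast
      show ?case
      proof (intro bexI[of _ "B \<union> Z"] conjI ballI)
        show "measure M (B \<union> Z) < \<eta>" using B Z by (simp add: measure_Un_null_set)
        show "B \<union> Z \<in> sets M" using B Z by auto
        fix \<omega> assume w: "\<omega> \<in> space M - (B \<union> Z)"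
        then have "regular \<omega>" using Zg by auto
        with elim(2) Bd[of \<omega>] w
        have "\<forall>p\<in>Delta_cube. \<bar>Cn M X n \<omega> p - ?A n \<omega> p\<bar> \<le> e" unfolding h(2) by auto
        then show "linf_dist Delta_cube (Cn M X n \<omega>) (?A n \<omega>) \<le> e"
          by (intro linf_dist_le[OF Delta_cube_nonempty]) auto
      qed
    qed
  qed
  have "(\<lambda>n. outer_prob M {\<omega>\<in>space M. (SUP p\<in>Delta_cube. \<bar>Cn M X n \<omega> p - ?A n \<omega> p\<bar>) > e}) \<longlonglongrightarrow> 0"
    if e: "0 < e" for e
  proof (rule order_tendstoI)
    fix \<eta> :: real assume \<eta>: "0 < \<eta>"
    from close[OF e \<eta>]
    show "\<forall>\<^sub>F n in sequentially. outer_prob M {\<omega>\<in>space M. (SUP p\<in>Delta_cube. \<bar>Cn M X n \<omega> p - ?A n \<omega> p\<bar>) > e} < \<eta>"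
    proof eventually_elim
      case (elim n)
      then obtain B where B: "B \<in> sets M" "measure M B < \<eta>"
        and Bd: "\<And>\<omega>. \<omega> \<in> space M - B \<Longrightarrow> linf_dist Delta_cube (Cn M X n \<omega>) (?A n \<omega>) \<le> e" by blast
      \<comment> \<open>The supremum need not be measurable, but its exceedance set lies in the
        measurable \<open>B\<close>, which is all that outer probability asks for.\<close>
      have "{\<omega>\<in>space M. (SUP p\<in>Delta_cube. \<bar>Cn M X n \<omega> p - ?A n \<omega> p\<bar>) > e} \<inter> space M \<subseteq> B"
        using Bd by (force simp: linf_dist_def)
      from outer_prob_le[OF B(1) this] B(2) show ?case by linarith
    qed
  qed (rule always_eventually, intro allI, erule less_le_trans[OF _ outer_prob_nonneg])
  \<comment> \<open>The approximating process is the same Lipschitz image of \<open>Bt\<close> as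
    the claimed limit is of \<open>BC\<close>, so continuous mapping applies; the bound
    \<open>close\<close> then passes the limit on to \<open>Cn\<close>.\<close>
  moreover have "hj_weak_conv M ?A N (\<lambda>\<omega>. approx_proc C (BC \<omega>)) Delta_cube"
    by (rule hj_weak_conv_map[OF Bt_conv approx_proc_in_linf _ T1_nonempty approx_proc_lipschitz]) auto
  then have "hj_weak_conv M (Cn M X) N (\<lambda>\<omega>. approx_proc C (BC \<omega>)) Delta_cube"
    by (rule hj_weak_conv_close[OF M N Delta_cube_nonempty _ Cn_in_linf close])
  ultimately show ?thesis by blast
qed

end
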